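(* Let $(\Omega_1,\Sigma_1,\mu)$ and $(\Omega_2,\Sigma_2,\nu)$ be finite atomless measure spaces. Then the set $\mathrm{NA}_\pi(L_1(\mu)\widehat{\otimes}_\pi L_1(\nu))$ is meager.
   Context: The scalar field is $\mathbb K\in\{\mathbb R,\mathbb C\}$. $X\widehat{\otimes}_\pi Y$ denotes the projective tensor product; $L_1(\mu)\widehat{\otimes}_\pi L_1(\nu)$ is isometrically identified with $L_1(\mu\otimes\nu)$. An element $u\in X\widehat{\otimes}_\pi Y$ attains its projective norm if there are $(x_i)\subseteq X$, $(y_i)\subseteq Y$ with $u=\sum_{i=1}^\infty x_i\otimes y_i$ and $\|u\|_\pi=\sum_{i=1}^\infty\|x_i\|\|y_i\|$; $\mathrm{NA}_\pi(X\widehat{\otimes}_\pi Y)$ is the set of such elements. A measurable set $A$ is an atom of $\mu$ if $0<\mu(A)<\infty$ and every measurable $B\subseteq A$ has $\mu(B)=0$ or $\mu(B)=\mu(A)$; a measure is atomless if it has no atoms. Meager means a countable union of nowhere dense sets, here in the norm topology of $L_1(\mu)\widehat{\otimes}_\pi L_1(\nu)$.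
   Formalization: Both measures are additionally assumed to be nonzero: if one of them is the zero measure, the projective tensor product is {0} and the norm-attaining set is the whole one-point space, which is not meager. *)

theory Defs
  imports "HOL-Analysis.Analysis"
begin

definition atom_of :: "'a measure \<Rightarrow> 'a set \<Rightarrow> bool" where
  "atom_of M A \<longleftrightarrow> A \<in> sets M \<and> 0 < emeasure M A \<and> emeasure M A < \<infinity> \<and>
     (\<forall>B\<in>sets M. B \<subseteq> A \<longrightarrow> emeasure M B = 0 \<or> emeasure M B = emeasure M A)"

definition atomless :: "'a measure \<Rightarrow> bool" where
  "atomless M \<longleftrightarrow> (\<nexists>A. atom_of M A)"

definition nowhere_dense_in :: "'a topology \<Rightarrow> 'a set \<Rightarrow> bool" where
  "nowhere_dense_in X S \<longleftrightarrow> S \<subseteq> topspace X \<and> X interior_of (X closure_of S) = {}"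

definition meager_in :: "'a topology \<Rightarrow> 'a set \<Rightarrow> bool" where
  "meager_in X S \<longleftrightarrow> (\<exists>F :: nat \<Rightarrow> 'a set. (\<forall>n. nowhere_dense_in X (F n)) \<and> S = (\<Union>n. F n))"

text \<open>
  Elements of the space of integrable functions are represented by functions; passing to classes
  modulo equality almost everywhere is built into the bilinear forms below.  The scalar field is
  the type variable \<open>'k\<close>, to be instantiated with the real or the complex numbers.
\<close>

definition L1 :: "'a measure \<Rightarrow> ('a \<Rightarrow> 'k::{real_normed_field,banach,second_countable_topology}) set"
  where "L1 M = {f. integrable M f}"

definition L1_norm :: "'a measure \<Rightarrow> ('a \<Rightarrow> 'k::{real_normed_field,banach,second_countable_topology}) \<Rightarrow> real"
  where "L1_norm M f = (\<integral>s. norm (f s) \<partial>M)"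

text \<open>
  All (not necessarily bounded) \<open>'k\<close>-bilinear forms on the product of the two spaces of classes:
  the last two conditions say that the form does not depend on the chosen representatives.
\<close>

definition bilinear_forms ::
  "'a measure \<Rightarrow> 'b measure \<Rightarrow>
    (('a \<Rightarrow> 'k::{real_normed_field,banach,second_countable_topology}) \<Rightarrow> ('b \<Rightarrow> 'k) \<Rightarrow> 'k) set" where
  "bilinear_forms M N = {\<beta>.
     (\<forall>x\<in>L1 M. \<forall>x'\<in>L1 M. \<forall>y\<in>L1 N. \<beta> (\<lambda>s. x s + x' s) y = \<beta> x y + \<beta> x' y) \<and>
     (\<forall>x\<in>L1 M. \<forall>y\<in>L1 N. \<forall>y'\<in>L1 N. \<beta> x (\<lambda>t. y t + y' t) = \<beta> x y + \<beta> x y') \<and>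
     (\<forall>c. \<forall>x\<in>L1 M. \<forall>y\<in>L1 N. \<beta> (\<lambda>s. c * x s) y = c * \<beta> x y) \<and>
     (\<forall>c. \<forall>x\<in>L1 M. \<forall>y\<in>L1 N. \<beta> x (\<lambda>t. c * y t) = c * \<beta> x y) \<and>
     (\<forall>x\<in>L1 M. \<forall>x'\<in>L1 M. \<forall>y\<in>L1 N. (AE s in M. x s = x' s) \<longrightarrow> \<beta> x y = \<beta> x' y) \<and>
     (\<forall>x\<in>L1 M. \<forall>y\<in>L1 N. \<forall>y'\<in>L1 N. (AE t in N. y t = y' t) \<longrightarrow> \<beta> x y = \<beta> x y')}"

text \<open>
  The algebraic tensor product, realised in the usual way as a space of linear functionals on the
  space of bilinear forms: the elementary tensor of \<open>x\<close> and \<open>y\<close> is evaluation at \<open>(x, y)\<close>.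
  Off the bilinear forms the functionals are set to 0, so that equality of tensors is equality of
  functions.
\<close>

type_synonym ('a, 'b, 'k) tensor = "(('a \<Rightarrow> 'k) \<Rightarrow> ('b \<Rightarrow> 'k) \<Rightarrow> 'k) \<Rightarrow> 'k"

definition elem_tensor ::
  "'a measure \<Rightarrow> 'b measure \<Rightarrow> ('a \<Rightarrow> 'k) \<Rightarrow> ('b \<Rightarrow> 'k) \<Rightarrow>
    ('a, 'b, 'k::{real_normed_field,banach,second_countable_topology}) tensor" where
  "elem_tensor M N x y = (\<lambda>\<beta>. if \<beta> \<in> bilinear_forms M N then \<beta> x y else 0)"

definition tensor_sum ::
  "'a measure \<Rightarrow> 'b measure \<Rightarrow> (nat \<Rightarrow> 'a \<Rightarrow> 'k) \<Rightarrow> (nat \<Rightarrow> 'b \<Rightarrow> 'k) \<Rightarrow> nat \<Rightarrow>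
    ('a, 'b, 'k::{real_normed_field,banach,second_countable_topology}) tensor" where
  "tensor_sum M N x y n = (\<lambda>\<beta>. \<Sum>i<n. elem_tensor M N (x i) (y i) \<beta>)"

definition alg_tensor ::
  "'a measure \<Rightarrow> 'b measure \<Rightarrow>
    ('a, 'b, 'k::{real_normed_field,banach,second_countable_topology}) tensor set" where
  "alg_tensor M N = {tensor_sum M N x y n | x y n. \<forall>i<n. x i \<in> L1 M \<and> y i \<in> L1 N}"

definition proj_norm ::
  "'a measure \<Rightarrow> 'b measure \<Rightarrow>
    ('a, 'b, 'k::{real_normed_field,banach,second_countable_topology}) tensor \<Rightarrow> real" where
  "proj_norm M N u = Inf {\<Sum>i<n. L1_norm M (x i) * L1_norm N (y i) | x y n.
     (\<forall>i<n. x i \<in> L1 M \<and> y i \<in> L1 N) \<and> u = tensor_sum M N x y n}"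

definition tensor_dist ::
  "'a measure \<Rightarrow> 'b measure \<Rightarrow>
    ('a, 'b, 'k::{real_normed_field,banach,second_countable_topology}) tensor \<Rightarrow>
    ('a, 'b, 'k) tensor \<Rightarrow> real" where
  "tensor_dist M N u v = proj_norm M N (\<lambda>\<beta>. u \<beta> - v \<beta>)"

text \<open>
  The completion of the algebraic tensor product in the projective norm, consisting of the Cauchy
  sequences modulo the sequences converging to 0.
\<close>

definition tensor_Cauchy ::
  "'a measure \<Rightarrow> 'b measure \<Rightarrow>
    (nat \<Rightarrow> ('a, 'b, 'k::{real_normed_field,banach,second_countable_topology}) tensor) set" where
  "tensor_Cauchy M N = {\<sigma>. (\<forall>n. \<sigma> n \<in> alg_tensor M N) \<and>
     (\<forall>\<epsilon>>0. \<exists>n0. \<forall>m\<ge>n0. \<forall>n\<ge>n0. tensor_dist M N (\<sigma> m) (\<sigma> n) < \<epsilon>)}"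

definition tensor_Cauchy_rel ::
  "'a measure \<Rightarrow> 'b measure \<Rightarrow>
    ((nat \<Rightarrow> ('a, 'b, 'k::{real_normed_field,banach,second_countable_topology}) tensor) \<times>
     (nat \<Rightarrow> ('a, 'b, 'k) tensor)) set" where
  "tensor_Cauchy_rel M N = {(\<sigma>, \<tau>). \<sigma> \<in> tensor_Cauchy M N \<and> \<tau> \<in> tensor_Cauchy M N \<and>
     (\<lambda>n. tensor_dist M N (\<sigma> n) (\<tau> n)) \<longlonglongrightarrow> 0}"

type_synonym ('a, 'b, 'k) ptensor = "(nat \<Rightarrow> ('a, 'b, 'k) tensor) set"

definition proj_tensor ::
  "'a measure \<Rightarrow> 'b measure \<Rightarrow>
    ('a, 'b, 'k::{real_normed_field,banach,second_countable_topology}) ptensor set" where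
  "proj_tensor M N = tensor_Cauchy M N // tensor_Cauchy_rel M N"

definition proj_tensor_embed ::
  "'a measure \<Rightarrow> 'b measure \<Rightarrow>
    ('a, 'b, 'k::{real_normed_field,banach,second_countable_topology}) tensor \<Rightarrow>
    ('a, 'b, 'k) ptensor" where
  "proj_tensor_embed M N u = tensor_Cauchy_rel M N `` {\<lambda>_. u}"

definition proj_tensor_norm ::
  "'a measure \<Rightarrow> 'b measure \<Rightarrow>
    ('a, 'b, 'k::{real_normed_field,banach,second_countable_topology}) ptensor \<Rightarrow> real" where
  "proj_tensor_norm M N U = lim (\<lambda>n. proj_norm M N ((SOME \<sigma>. \<sigma> \<in> U) n))"

text \<open>
  The value off the carrier is fixed because the locale \<open>Metric_space\<close> demands a function that
  is nonnegative and symmetric everywhere.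
\<close>

definition proj_tensor_dist ::
  "'a measure \<Rightarrow> 'b measure \<Rightarrow>
    ('a, 'b, 'k::{real_normed_field,banach,second_countable_topology}) ptensor \<Rightarrow>
    ('a, 'b, 'k) ptensor \<Rightarrow> real" where
  "proj_tensor_dist M N U V =
     (if U \<in> proj_tensor M N \<and> V \<in> proj_tensor M N
      then lim (\<lambda>n. tensor_dist M N ((SOME \<sigma>. \<sigma> \<in> U) n) ((SOME \<tau>. \<tau> \<in> V) n))
      else 0)"

definition proj_tensor_topology ::
  "'a measure \<Rightarrow> 'b measure \<Rightarrow>
    ('a, 'b, 'k::{real_normed_field,banach,second_countable_topology}) ptensor topology" where
  "proj_tensor_topology M N = Metric_space.mtopology (proj_tensor M N) (proj_tensor_dist M N)"

definition NA_proj_tensor ::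
  "'a measure \<Rightarrow> 'b measure \<Rightarrow>
    ('a, 'b, 'k::{real_normed_field,banach,second_countable_topology}) ptensor set" where
  "NA_proj_tensor M N = {U \<in> proj_tensor M N. \<exists>x y. (\<forall>i. x i \<in> L1 M \<and> y i \<in> L1 N) \<and>
     limitin (proj_tensor_topology M N)
       (\<lambda>n. proj_tensor_embed M N (tensor_sum M N x y n)) U sequentially \<and>
     (\<lambda>i. L1_norm M (x i) * L1_norm N (y i)) sums proj_tensor_norm M N U}"

end

theory Submission
  imports Defs
begin

text \<open>
  If \<open>U = (\<Sum>i. x i \<otimes> y i)\<close> attains its projective norm, then all the functions \<open>x i s * y i t\<close> have
  almost everywhere the same direction, since otherwise two terms could be merged on a small rectangle at
  a smaller cost. As each single term is a product, a nonzero \<open>U\<close> is therefore bounded away from \<open>0\<close> in a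
  fixed direction on a whole rectangle \<open>A \<times> B\<close> of positive measure. Quantifying the bound and the
  measures, the norm-attaining tensors with nonzero total integral are covered by countably many sets
  \<open>large_on_rectangle\<close>, and the tensors with integral \<open>0\<close> form a proper closed subspace. Each \<open>large_on_rectangle\<close> is nowhere dense:
  there are sets of arbitrarily small measure in the product that meet every large rectangle
  substantially, and erasing a given tensor there changes it little but takes it away from
  \<open>large_on_rectangle\<close>.
\<close>

subsection \<open>The projective norm on the algebraic tensor product\<close>

text \<open>The identification with the integrable functions on the product space is never carried
  out. A tensor is observed only through \<open>rect_form\<close>, which under that identification
  is integration over a rectangle; being large on a rectangle is expressed by the integrals over all
  its subrectangles. Terms are compared pointwise at points whose values lie in the essential ranges
  of the factors. This replaces Lebesgue points, for which an abstract measure space offers no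
  balls. Alignment with one fixed nonzero term excludes cancellation, so that this term alone bounds
  the whole series from below. A nonzero total integral serves as the certificate that such a term
  exists. The main obstacle is the erased set. A product set that is small because one side is small
  can miss large rectangles altogether, so the erased set has to be spread out like a random one. It
  is coded by words: over each piece of \<open>N\<close> lie only a few pieces of \<open>M\<close>,
  yet most words contain a letter from any prescribed large set of letters.\<close>

lemma L1_iff [simp]: "f \<in> L1 M \<longleftrightarrow> integrable M f"
  by (simp add: L1_def)

lemma L1_norm_nonneg [simp]: "0 \<le> L1_norm M f"
  by (simp add: L1_norm_def)

lemma bilinear_forms_add_left:
  "\<lbrakk>\<beta> \<in> bilinear_forms M N; integrable M x; integrable M x'; integrable N y\<rbrakk>
    \<Longrightarrow> \<beta> (\<lambda>s. x s + x' s) y = \<beta> x y + \<beta> x' y"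
  unfolding bilinear_forms_def L1_def by blast

lemma bilinear_forms_add_right:
  "\<lbrakk>\<beta> \<in> bilinear_forms M N; integrable M x; integrable N y; integrable N y'\<rbrakk>
    \<Longrightarrow> \<beta> x (\<lambda>t. y t + y' t) = \<beta> x y + \<beta> x y'"
  unfolding bilinear_forms_def L1_def by blast

lemma bilinear_forms_scale_left:
  "\<lbrakk>\<beta> \<in> bilinear_forms M N; integrable M x; integrable N y\<rbrakk>
    \<Longrightarrow> \<beta> (\<lambda>s. c * x s) y = c * \<beta> x y"
  unfolding bilinear_forms_def L1_def by blast

lemma bilinear_forms_scale_right:
  "\<lbrakk>\<beta> \<in> bilinear_forms M N; integrable M x; integrable N y\<rbrakk>
    \<Longrightarrow> \<beta> x (\<lambda>t. c * y t) = c * \<beta> x y"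
  unfolding bilinear_forms_def L1_def by blast

lemma elem_tensor_add_left:
  assumes "integrable M x" "integrable M x'" "integrable N y"
  shows "elem_tensor M N (\<lambda>s. x s + x' s) y \<beta> = elem_tensor M N x y \<beta> + elem_tensor M N x' y \<beta>"
  using bilinear_forms_add_left[OF _ assms] by (simp add: elem_tensor_def)

lemma elem_tensor_add_right:
  assumes "integrable M x" "integrable N y" "integrable N y'"
  shows "elem_tensor M N x (\<lambda>t. y t + y' t) \<beta> = elem_tensor M N x y \<beta> + elem_tensor M N x y' \<beta>"
  using bilinear_forms_add_right[OF _ assms] by (simp add: elem_tensor_def)

lemma elem_tensor_scale_left:
  assumes "integrable M x" "integrable N y"
  shows "elem_tensor M N (\<lambda>s. c * x s) y \<beta> = c * elem_tensor M N x y \<beta>"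
  using bilinear_forms_scale_left[OF _ assms] by (simp add: elem_tensor_def)

lemma elem_tensor_scale_right:
  assumes "integrable M x" "integrable N y"
  shows "elem_tensor M N x (\<lambda>t. c * y t) \<beta> = c * elem_tensor M N x y \<beta>"
  using bilinear_forms_scale_right[OF _ assms] by (simp add: elem_tensor_def)

lemma alg_tensorE:
  assumes "u \<in> alg_tensor M N"
  obtains x y n where "\<forall>i<n. integrable M (x i) \<and> integrable N (y i)"
    "u = tensor_sum M N x y n"
  using assms by (auto simp: alg_tensor_def)

lemma tensor_sum_in_alg_tensor:
  assumes "\<forall>i<n. integrable M (x i) \<and> integrable N (y i)"
  shows "tensor_sum M N x y n \<in> alg_tensor M N"
  using assms unfolding alg_tensor_def L1_iff by blast

lemma proj_norm_tensor_sum_le: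
  assumes "\<forall>i<n. integrable M (x i) \<and> integrable N (y i)"
  shows "proj_norm M N (tensor_sum M N x y n) \<le> (\<Sum>i<n. L1_norm M (x i) * L1_norm N (y i))"
  unfolding proj_norm_def
proof (rule cInf_lower)
  show "bdd_below {\<Sum>i<k. L1_norm M (x' i) * L1_norm N (y' i) |x' y' k.
       (\<forall>i<k. x' i \<in> L1 M \<and> y' i \<in> L1 N) \<and> tensor_sum M N x y n = tensor_sum M N x' y' k}"
    by (rule bdd_belowI[of _ 0]) (auto intro!: sum_nonneg)
qed (use assms in \<open>unfold L1_iff mem_Collect_eq, blast\<close>)

lemma proj_norm_approx:
  assumes "u \<in> alg_tensor M N" "0 < \<epsilon>"
  obtains x y n where "\<forall>i<n. integrable M (x i) \<and> integrable N (y i)"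
    "u = tensor_sum M N x y n"
    "(\<Sum>i<n. L1_norm M (x i) * L1_norm N (y i)) < proj_norm M N u + \<epsilon>"
proof -
  let ?S = "{\<Sum>i<n. L1_norm M (x i) * L1_norm N (y i) | x y n.
     (\<forall>i<n. x i \<in> L1 M \<and> y i \<in> L1 N) \<and> u = tensor_sum M N x y n}"
  have "?S \<noteq> {}"
    using assms(1) by (auto simp: alg_tensor_def)
  moreover have "Inf ?S < proj_norm M N u + \<epsilon>"
    using assms(2) by (simp add: proj_norm_def)
  ultimately obtain z where "z \<in> ?S" "z < proj_norm M N u + \<epsilon>"
    by (meson cInf_lessD)
  then show ?thesis
    using that by auto
qed

lemma proj_norm_nonneg:
  assumes "u \<in> alg_tensor M N"
  shows "0 \<le> proj_norm M N u"
proof (rule field_le_epsilon)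
  fix e :: real assume "0 < e"
  then obtain x y n where "\<forall>i<n. integrable M (x i) \<and> integrable N (y i)" "u = tensor_sum M N x y n"
    "(\<Sum>i<n. L1_norm M (x i) * L1_norm N (y i)) < proj_norm M N u + e"
    by (rule proj_norm_approx[OF assms])
  moreover have "0 \<le> (\<Sum>i<n. L1_norm M (x i) * L1_norm N (y i))"
    by (intro sum_nonneg mult_nonneg_nonneg) simp_all
  ultimately show "0 \<le> proj_norm M N u + e"
    by linarith
qed

section \<open>Elementary tensors and the seminorm properties of the projective norm\<close>

lemma elem_tensor_eq_tensor_sum: "elem_tensor M N x y = tensor_sum M N (\<lambda>_. x) (\<lambda>_. y) (Suc 0)"
  by (simp add: tensor_sum_def)

lemma elem_tensor_in_alg_tensor:
  assumes "integrable M x" "integrable N y"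
  shows "elem_tensor M N x y \<in> alg_tensor M N"
  unfolding elem_tensor_eq_tensor_sum using assms by (simp add: tensor_sum_in_alg_tensor)

lemma proj_norm_elem_tensor_le:
  assumes "integrable M x" "integrable N y"
  shows "proj_norm M N (elem_tensor M N x y) \<le> L1_norm M x * L1_norm N y"
  using proj_norm_tensor_sum_le[of "Suc 0" M "\<lambda>_. x" N "\<lambda>_. y"] assms
  by (simp add: elem_tensor_eq_tensor_sum)

lemma sum_lessThan_add:
  fixes f :: "nat \<Rightarrow> 'c::comm_monoid_add"
  shows "(\<Sum>i<n + m. f i) = (\<Sum>i<n. f i) + (\<Sum>i<m. f (n + i))"
  by (induction m) (simp_all add: add.assoc)

lemma tensor_sum_append:
  "(\<lambda>\<beta>. tensor_sum M N x y n \<beta> + tensor_sum M N x' y' n' \<beta>) =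
   tensor_sum M N (\<lambda>i. if i < n then x i else x' (i - n)) (\<lambda>i. if i < n then y i else y' (i - n)) (n + n')"
  by (rule ext) (simp add: tensor_sum_def sum_lessThan_add)

lemma alg_tensor_add:
  assumes "u \<in> alg_tensor M N" "v \<in> alg_tensor M N"
  shows "(\<lambda>\<beta>. u \<beta> + v \<beta>) \<in> alg_tensor M N"
  using assms
  by (elim alg_tensorE) (auto simp: tensor_sum_append intro!: tensor_sum_in_alg_tensor)

lemma proj_norm_add_le:
  assumes "u \<in> alg_tensor M N" "v \<in> alg_tensor M N"
  shows "proj_norm M N (\<lambda>\<beta>. u \<beta> + v \<beta>) \<le> proj_norm M N u + proj_norm M N v"
proof (rule field_le_epsilon)
  fix e :: real assume "0 < e"
  then have e: "0 < e / 2" by simp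
  obtain x y n where u: "\<forall>i<n. integrable M (x i) \<and> integrable N (y i)"
    "u = tensor_sum M N x y n"
    "(\<Sum>i<n. L1_norm M (x i) * L1_norm N (y i)) < proj_norm M N u + e / 2"
    by (rule proj_norm_approx[OF assms(1) e])
  obtain x' y' n' where v: "\<forall>i<n'. integrable M (x' i) \<and> integrable N (y' i)"
    "v = tensor_sum M N x' y' n'"
    "(\<Sum>i<n'. L1_norm M (x' i) * L1_norm N (y' i)) < proj_norm M N v + e / 2"
    by (rule proj_norm_approx[OF assms(2) e])
  have "proj_norm M N (\<lambda>\<beta>. u \<beta> + v \<beta>) \<le>
      (\<Sum>i<n. L1_norm M (x i) * L1_norm N (y i)) + (\<Sum>i<n'. L1_norm M (x' i) * L1_norm N (y' i))"
    unfolding u(2) v(2) tensor_sum_append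
    by (rule order_trans[OF proj_norm_tensor_sum_le]) (use u v in \<open>auto simp: sum_lessThan_add\<close>)
  then show "proj_norm M N (\<lambda>\<beta>. u \<beta> + v \<beta>) \<le> proj_norm M N u + proj_norm M N v + e"
    using u(3) v(3) by linarith
qed

lemma minus_tensor_sum:
  assumes "\<forall>i<n. integrable M (x i) \<and> integrable N (y i)"
  shows "(\<lambda>\<beta>. - tensor_sum M N x y n \<beta>) = tensor_sum M N (\<lambda>i s. - x i s) y n"
proof -
  have "elem_tensor M N (\<lambda>s. - x i s) (y i) \<beta> = - elem_tensor M N (x i) (y i) \<beta>" if "i < n" for i \<beta>
    using assms that elem_tensor_scale_left[of M "x i" N "y i" "-1"] by simp
  then show ?thesis
    by (auto simp: tensor_sum_def sum_negf)
qed

lemma alg_tensor_minus: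
  assumes "u \<in> alg_tensor M N"
  shows "(\<lambda>\<beta>. - u \<beta>) \<in> alg_tensor M N"
  using assms
  by (elim alg_tensorE) (auto simp: minus_tensor_sum intro!: tensor_sum_in_alg_tensor)

lemma proj_norm_minus_le:
  assumes "u \<in> alg_tensor M N"
  shows "proj_norm M N (\<lambda>\<beta>. - u \<beta>) \<le> proj_norm M N u"
proof (rule field_le_epsilon)
  fix e :: real assume e: "0 < e"
  obtain x y n where u: "\<forall>i<n. integrable M (x i) \<and> integrable N (y i)"
    "u = tensor_sum M N x y n"
    "(\<Sum>i<n. L1_norm M (x i) * L1_norm N (y i)) < proj_norm M N u + e"
    by (rule proj_norm_approx[OF assms e])
  have "proj_norm M N (\<lambda>\<beta>. - u \<beta>) \<le> (\<Sum>i<n. L1_norm M (\<lambda>s. - x i s) * L1_norm N (y i))"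
    unfolding u(2) using u(1) by (subst minus_tensor_sum) (auto intro!: proj_norm_tensor_sum_le)
  then show "proj_norm M N (\<lambda>\<beta>. - u \<beta>) \<le> proj_norm M N u + e"
    using u(3) by (simp add: L1_norm_def)
qed

lemma alg_tensor_diff:
  assumes "u \<in> alg_tensor M N" "v \<in> alg_tensor M N"
  shows "(\<lambda>\<beta>. u \<beta> - v \<beta>) \<in> alg_tensor M N"
  using alg_tensor_add[OF assms(1) alg_tensor_minus[OF assms(2)]] by simp

lemma alg_tensor_zero: "(\<lambda>\<beta>. 0) \<in> alg_tensor M N"
  using tensor_sum_in_alg_tensor[of 0 M _ N] by (simp add: tensor_sum_def)

lemma proj_norm_zero: "proj_norm M N (\<lambda>\<beta>. 0) = 0"
proof (rule antisym)
  show "proj_norm M N (\<lambda>\<beta>. 0) \<le> 0"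
    using proj_norm_tensor_sum_le[of 0 M _ N] by (simp add: tensor_sum_def)
qed (rule proj_norm_nonneg[OF alg_tensor_zero])

lemma
  assumes "finite I" "\<And>i. i \<in> I \<Longrightarrow> u i \<in> alg_tensor M N"
  shows alg_tensor_sum: "(\<lambda>\<beta>. \<Sum>i\<in>I. u i \<beta>) \<in> alg_tensor M N"
    and proj_norm_sum_le: "proj_norm M N (\<lambda>\<beta>. \<Sum>i\<in>I. u i \<beta>) \<le> (\<Sum>i\<in>I. proj_norm M N (u i))"
proof -
  have "(\<lambda>\<beta>. \<Sum>i\<in>I. u i \<beta>) \<in> alg_tensor M N \<and>
    proj_norm M N (\<lambda>\<beta>. \<Sum>i\<in>I. u i \<beta>) \<le> (\<Sum>i\<in>I. proj_norm M N (u i))"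
    using assms
  proof (induction I rule: finite_induct)
    case empty
    then show ?case by (simp add: alg_tensor_zero proj_norm_zero)
  next
    case (insert i I)
    then show ?case
      using proj_norm_add_le[of "u i" M N "\<lambda>\<beta>. \<Sum>i\<in>I. u i \<beta>"]
      by (auto intro!: alg_tensor_add)
  qed
  then show "(\<lambda>\<beta>. \<Sum>i\<in>I. u i \<beta>) \<in> alg_tensor M N"
    "proj_norm M N (\<lambda>\<beta>. \<Sum>i\<in>I. u i \<beta>) \<le> (\<Sum>i\<in>I. proj_norm M N (u i))"
    by auto
qed

lemma tensor_dist_nonneg:
  assumes "u \<in> alg_tensor M N" "v \<in> alg_tensor M N"
  shows "0 \<le> tensor_dist M N u v"
  unfolding tensor_dist_def by (intro proj_norm_nonneg alg_tensor_diff assms)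

lemma tensor_dist_self: "tensor_dist M N u u = 0"
  by (simp add: tensor_dist_def proj_norm_zero)

lemma tensor_dist_commute:
  assumes "u \<in> alg_tensor M N" "v \<in> alg_tensor M N"
  shows "tensor_dist M N u v = tensor_dist M N v u"
  using proj_norm_minus_le[OF alg_tensor_diff[OF assms]]
    proj_norm_minus_le[OF alg_tensor_diff[OF assms(2,1)]]
  by (simp add: tensor_dist_def)

lemma tensor_dist_triangle:
  assumes "u \<in> alg_tensor M N" "v \<in> alg_tensor M N" "w \<in> alg_tensor M N"
  shows "tensor_dist M N u w \<le> tensor_dist M N u v + tensor_dist M N v w"
  using proj_norm_add_le[OF alg_tensor_diff[OF assms(1,2)] alg_tensor_diff[OF assms(2,3)]]
  by (simp add: tensor_dist_def)

lemma tensor_dist_zero_right: "tensor_dist M N u (\<lambda>\<beta>. 0) = proj_norm M N u"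
  by (simp add: tensor_dist_def)

text \<open>The forms of norm at most 1, that is, the unit ball of the dual of the projective tensor
  product. The bound 1 makes evaluation at such a form a contraction, which therefore extends to the
  completion.\<close>

definition bounded_bilinear_forms ::
  "'a measure \<Rightarrow> 'b measure \<Rightarrow>
    (('a \<Rightarrow> 'k::{real_normed_field,banach,second_countable_topology}) \<Rightarrow> ('b \<Rightarrow> 'k) \<Rightarrow> 'k) set" where
  "bounded_bilinear_forms M N = {\<beta> \<in> bilinear_forms M N.
     \<forall>x y. integrable M x \<longrightarrow> integrable N y \<longrightarrow> norm (\<beta> x y) \<le> L1_norm M x * L1_norm N y}"

lemma tensor_sum_apply:
  "\<beta> \<in> bilinear_forms M N \<Longrightarrow> tensor_sum M N x y n \<beta> = (\<Sum>i<n. \<beta> (x i) (y i))"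
  by (simp add: tensor_sum_def elem_tensor_def)

text \<open>The easy half of the duality: apply the triangle inequality to a representation that is
  optimal up to \<open>e\<close>.\<close>

lemma norm_eval_le_proj_norm:
  assumes "u \<in> alg_tensor M N" "\<beta> \<in> bounded_bilinear_forms M N"
  shows "norm (u \<beta>) \<le> proj_norm M N u"
proof (rule field_le_epsilon)
  fix e :: real assume e: "0 < e"
  obtain x y n where u: "\<forall>i<n. integrable M (x i) \<and> integrable N (y i)"
    "u = tensor_sum M N x y n"
    "(\<Sum>i<n. L1_norm M (x i) * L1_norm N (y i)) < proj_norm M N u + e"
    by (rule proj_norm_approx[OF assms(1) e])
  have "norm (u \<beta>) \<le> (\<Sum>i<n. norm (\<beta> (x i) (y i)))"
    using assms(2) by (simp add: u(2) tensor_sum_apply bounded_bilinear_forms_def norm_sum)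
  also have "\<dots> \<le> (\<Sum>i<n. L1_norm M (x i) * L1_norm N (y i))"
    using assms(2) u(1) by (intro sum_mono) (auto simp: bounded_bilinear_forms_def)
  finally show "norm (u \<beta>) \<le> proj_norm M N u + e"
    using u(3) by simp
qed

lemma norm_eval_diff_le_tensor_dist:
  assumes "u \<in> alg_tensor M N" "v \<in> alg_tensor M N" "\<beta> \<in> bounded_bilinear_forms M N"
  shows "norm (u \<beta> - v \<beta>) \<le> tensor_dist M N u v"
  using norm_eval_le_proj_norm[OF alg_tensor_diff[OF assms(1,2)] assms(3)]
  by (simp add: tensor_dist_def)

subsection \<open>The completion\<close>

lemma tensor_Cauchy_in_alg: "\<sigma> \<in> tensor_Cauchy M N \<Longrightarrow> \<sigma> n \<in> alg_tensor M N"
  by (simp add: tensor_Cauchy_def)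

lemma tensor_CauchyD:
  assumes "\<sigma> \<in> tensor_Cauchy M N" "0 < \<epsilon>"
  obtains n0 where "\<forall>m\<ge>n0. \<forall>n\<ge>n0. tensor_dist M N (\<sigma> m) (\<sigma> n) < \<epsilon>"
  using assms unfolding tensor_Cauchy_def by blast

lemma equiv_tensor_Cauchy_rel: "equiv (tensor_Cauchy M N) (tensor_Cauchy_rel M N)"
proof (rule equivI)
  show "tensor_Cauchy_rel M N \<subseteq> tensor_Cauchy M N \<times> tensor_Cauchy M N"
    by (auto simp: tensor_Cauchy_rel_def)
  show "refl_on (tensor_Cauchy M N) (tensor_Cauchy_rel M N)"
    by (auto simp: refl_on_def tensor_Cauchy_rel_def tensor_dist_self)
  show "sym (tensor_Cauchy_rel M N)"
  proof (rule symI)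
    fix \<sigma> \<tau> assume *: "(\<sigma>, \<tau>) \<in> tensor_Cauchy_rel M N"
    then have "tensor_dist M N (\<sigma> n) (\<tau> n) = tensor_dist M N (\<tau> n) (\<sigma> n)" for n
      by (intro tensor_dist_commute tensor_Cauchy_in_alg) (auto simp: tensor_Cauchy_rel_def)
    with * show "(\<tau>, \<sigma>) \<in> tensor_Cauchy_rel M N"
      by (simp add: tensor_Cauchy_rel_def)
  qed
  show "trans (tensor_Cauchy_rel M N)"
  proof (rule transI)
    fix \<rho> \<sigma> \<tau> assume *: "(\<rho>, \<sigma>) \<in> tensor_Cauchy_rel M N" "(\<sigma>, \<tau>) \<in> tensor_Cauchy_rel M N"
    then have alg: "\<rho> n \<in> alg_tensor M N" "\<sigma> n \<in> alg_tensor M N" "\<tau> n \<in> alg_tensor M N" for n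
      by (auto simp: tensor_Cauchy_rel_def tensor_Cauchy_in_alg)
    have "(\<lambda>n. tensor_dist M N (\<rho> n) (\<sigma> n) + tensor_dist M N (\<sigma> n) (\<tau> n)) \<longlonglongrightarrow> 0 + 0"
      using * by (intro tendsto_add) (auto simp: tensor_Cauchy_rel_def)
    moreover have "norm (tensor_dist M N (\<rho> n) (\<tau> n)) \<le>
        tensor_dist M N (\<rho> n) (\<sigma> n) + tensor_dist M N (\<sigma> n) (\<tau> n)" for n
      using tensor_dist_nonneg[OF alg(1)[of n] alg(3)[of n]]
        tensor_dist_triangle[OF alg(1)[of n] alg(2)[of n] alg(3)[of n]] by simp
    ultimately have "(\<lambda>n. tensor_dist M N (\<rho> n) (\<tau> n)) \<longlonglongrightarrow> 0"
      by (metis (no_types, lifting) Lim_null_comparison add_0 always_eventually)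
    with * show "(\<rho>, \<tau>) \<in> tensor_Cauchy_rel M N"
      by (simp add: tensor_Cauchy_rel_def)
  qed
qed

lemma proj_tensorD:
  assumes "U \<in> proj_tensor M N"
  shows proj_tensor_some_in: "(SOME \<sigma>. \<sigma> \<in> U) \<in> U"
    and proj_tensor_Cauchy: "\<sigma> \<in> U \<Longrightarrow> \<sigma> \<in> tensor_Cauchy M N"
    and proj_tensor_rel: "\<sigma> \<in> U \<Longrightarrow> \<tau> \<in> U \<Longrightarrow> (\<sigma>, \<tau>) \<in> tensor_Cauchy_rel M N"
proof -
  note e = equiv_tensor_Cauchy_rel[of M N]
  have "U \<noteq> {}"
    using assms in_quotient_imp_non_empty[OF e] by (simp add: proj_tensor_def)
  then show "(SOME \<sigma>. \<sigma> \<in> U) \<in> U"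
    by (simp add: some_in_eq)
  show "\<sigma> \<in> U \<Longrightarrow> \<sigma> \<in> tensor_Cauchy M N"
    using assms in_quotient_imp_subset[OF e] by (auto simp: proj_tensor_def)
  show "\<sigma> \<in> U \<Longrightarrow> \<tau> \<in> U \<Longrightarrow> (\<sigma>, \<tau>) \<in> tensor_Cauchy_rel M N"
    using assms in_quotient_imp_in_rel[OF e, of U \<sigma> \<tau>] by (auto simp: proj_tensor_def)
qed

text \<open>The distance is 1-Lipschitz in each argument. This gives both the convergence of
  distances along Cauchy sequences and the independence of the limit from the
  representatives.\<close>

lemma tensor_dist_quadrilateral:
  assumes "u \<in> alg_tensor M N" "u' \<in> alg_tensor M N" "v \<in> alg_tensor M N" "v' \<in> alg_tensor M N"
  shows "\<bar>tensor_dist M N u v - tensor_dist M N u' v'\<bar> \<le> tensor_dist M N u u' + tensor_dist M N v v'"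
  using tensor_dist_triangle[OF assms(1,2,3)] tensor_dist_triangle[OF assms(2,4,3)]
    tensor_dist_triangle[OF assms(2,1,4)] tensor_dist_triangle[OF assms(1,3,4)]
    tensor_dist_commute[OF assms(1,2)] tensor_dist_commute[OF assms(3,4)]
  by linarith

lemma convergent_tensor_dist:
  assumes "\<sigma> \<in> tensor_Cauchy M N" "\<tau> \<in> tensor_Cauchy M N"
  shows "convergent (\<lambda>n. tensor_dist M N (\<sigma> n) (\<tau> n))"
proof (rule Cauchy_convergent, rule metric_CauchyI)
  fix e :: real assume "0 < e"
  then have e: "0 < e / 2" by simp
  obtain n1 where n1: "\<forall>m\<ge>n1. \<forall>n\<ge>n1. tensor_dist M N (\<sigma> m) (\<sigma> n) < e / 2"
    by (rule tensor_CauchyD[OF assms(1) e])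
  obtain n2 where n2: "\<forall>m\<ge>n2. \<forall>n\<ge>n2. tensor_dist M N (\<tau> m) (\<tau> n) < e / 2"
    by (rule tensor_CauchyD[OF assms(2) e])
  show "\<exists>n0. \<forall>m\<ge>n0. \<forall>n\<ge>n0.
      dist (tensor_dist M N (\<sigma> m) (\<tau> m)) (tensor_dist M N (\<sigma> n) (\<tau> n)) < e"
  proof (intro exI[of _ "max n1 n2"] allI impI)
    fix m n assume "max n1 n2 \<le> m" "max n1 n2 \<le> n"
    then have "tensor_dist M N (\<sigma> m) (\<sigma> n) < e / 2" "tensor_dist M N (\<tau> m) (\<tau> n) < e / 2"
      using n1 n2 by auto
    then show "dist (tensor_dist M N (\<sigma> m) (\<tau> m)) (tensor_dist M N (\<sigma> n) (\<tau> n)) < e"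
      using tensor_dist_quadrilateral[of "\<sigma> m" M N "\<sigma> n" "\<tau> m" "\<tau> n"] assms
      by (auto simp: dist_real_def tensor_Cauchy_in_alg)
  qed
qed

text \<open>Frees the distance from the representatives picked by \<open>SOME\<close>: changing both
  sequences within their classes alters the distances by a null sequence. Later limits can use
  whichever representatives are convenient, in particular constant ones.\<close>

lemma tensor_dist_tendsto_proj_tensor_dist:
  assumes "U \<in> proj_tensor M N" "V \<in> proj_tensor M N" "\<sigma> \<in> U" "\<tau> \<in> V"
  shows "(\<lambda>n. tensor_dist M N (\<sigma> n) (\<tau> n)) \<longlonglongrightarrow> proj_tensor_dist M N U V"
proof -
  define \<sigma>0 \<tau>0 where "\<sigma>0 = (SOME \<sigma>. \<sigma> \<in> U)" and "\<tau>0 = (SOME \<tau>. \<tau> \<in> V)"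
  have in0: "\<sigma>0 \<in> U" "\<tau>0 \<in> V"
    using assms proj_tensor_some_in by (auto simp: \<sigma>0_def \<tau>0_def)
  note Cauchy = proj_tensor_Cauchy[OF assms(1)] proj_tensor_Cauchy[OF assms(2)]
  have "(\<lambda>n. tensor_dist M N (\<sigma>0 n) (\<tau>0 n)) \<longlonglongrightarrow> proj_tensor_dist M N U V"
    using convergent_tensor_dist[of \<sigma>0 M N \<tau>0] Cauchy in0 assms
    by (simp add: proj_tensor_dist_def convergent_LIMSEQ_iff flip: \<sigma>0_def \<tau>0_def)
  moreover have "(\<lambda>n. tensor_dist M N (\<sigma> n) (\<tau> n) - tensor_dist M N (\<sigma>0 n) (\<tau>0 n)) \<longlonglongrightarrow> 0"
  proof (rule Lim_null_comparison)
    show "\<forall>\<^sub>F n in sequentially. norm (tensor_dist M N (\<sigma> n) (\<tau> n) - tensor_dist M N (\<sigma>0 n) (\<tau>0 n))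
        \<le> tensor_dist M N (\<sigma> n) (\<sigma>0 n) + tensor_dist M N (\<tau> n) (\<tau>0 n)"
      using assms in0 Cauchy
      by (auto intro!: eventuallyI tensor_dist_quadrilateral tensor_Cauchy_in_alg)
    have "(\<lambda>n. tensor_dist M N (\<sigma> n) (\<sigma>0 n)) \<longlonglongrightarrow> 0" "(\<lambda>n. tensor_dist M N (\<tau> n) (\<tau>0 n)) \<longlonglongrightarrow> 0"
      using proj_tensor_rel[OF assms(1,3) in0(1)] proj_tensor_rel[OF assms(2,4) in0(2)]
      by (auto simp: tensor_Cauchy_rel_def)
    then show "(\<lambda>n. tensor_dist M N (\<sigma> n) (\<sigma>0 n) + tensor_dist M N (\<tau> n) (\<tau>0 n)) \<longlonglongrightarrow> 0"
      using tendsto_add by fastforce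
  qed
  ultimately show ?thesis
    using tendsto_add by fastforce
qed

lemma Metric_space_proj_tensor:
  fixes M :: "'a measure" and N :: "'b measure"
  shows "Metric_space (proj_tensor M N :: ('a, 'b, 'k::{real_normed_field,banach,second_countable_topology}) ptensor set)
    (proj_tensor_dist M N)"
proof
  fix U V :: "('a, 'b, 'k) ptensor"
  show "0 \<le> proj_tensor_dist M N U V"
  proof (cases "U \<in> proj_tensor M N \<and> V \<in> proj_tensor M N")
    case True
    then obtain \<sigma> \<tau> where in0: "\<sigma> \<in> U" "\<tau> \<in> V"
      by (metis proj_tensor_some_in)
    show ?thesis
      using True in0 proj_tensor_Cauchy[of _ M N]
      by (intro LIMSEQ_le_const[OF tensor_dist_tendsto_proj_tensor_dist[of U M N V \<sigma> \<tau>]])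
        (auto intro!: tensor_dist_nonneg tensor_Cauchy_in_alg)
  qed (auto simp: proj_tensor_dist_def)
next
  fix U V :: "('a, 'b, 'k) ptensor"
  show "proj_tensor_dist M N U V = proj_tensor_dist M N V U"
  proof (cases "U \<in> proj_tensor M N \<and> V \<in> proj_tensor M N")
    case True
    then obtain \<sigma> \<tau> where in0: "\<sigma> \<in> U" "\<tau> \<in> V"
      by (metis proj_tensor_some_in)
    have "tensor_dist M N (\<tau> n) (\<sigma> n) = tensor_dist M N (\<sigma> n) (\<tau> n)" for n
      using True in0 proj_tensor_Cauchy[of _ M N]
      by (intro tensor_dist_commute tensor_Cauchy_in_alg) auto
    then show ?thesis
      using True in0 tensor_dist_tendsto_proj_tensor_dist[of U M N V \<sigma> \<tau>]
        tensor_dist_tendsto_proj_tensor_dist[of V M N U \<tau> \<sigma>] LIMSEQ_unique by simp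
  qed (auto simp: proj_tensor_dist_def)
next
  fix U V :: "('a, 'b, 'k) ptensor"
  assume UV: "U \<in> proj_tensor M N" "V \<in> proj_tensor M N"
  then obtain \<sigma> \<tau> where in0: "\<sigma> \<in> U" "\<tau> \<in> V"
    by (metis proj_tensor_some_in)
  note lim = tensor_dist_tendsto_proj_tensor_dist[OF UV in0]
  note Cauchy = proj_tensor_Cauchy[OF UV(1) in0(1)] proj_tensor_Cauchy[OF UV(2) in0(2)]
  show "proj_tensor_dist M N U V = 0 \<longleftrightarrow> U = V"
  proof
    assume "proj_tensor_dist M N U V = 0"
    then have "(\<sigma>, \<tau>) \<in> tensor_Cauchy_rel M N"
      using lim Cauchy by (simp add: tensor_Cauchy_rel_def)
    then show "U = V"
      using quotient_eqI[OF equiv_tensor_Cauchy_rel] UV in0 unfolding proj_tensor_def by metis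
  next
    assume "U = V"
    then have "(\<lambda>n. tensor_dist M N (\<sigma> n) (\<sigma> n)) \<longlonglongrightarrow> proj_tensor_dist M N U V"
      using UV in0 by (intro tensor_dist_tendsto_proj_tensor_dist) auto
    then show "proj_tensor_dist M N U V = 0"
      by (simp add: tensor_dist_self LIMSEQ_const_iff)
  qed
next
  fix U V W :: "('a, 'b, 'k) ptensor"
  assume UVW: "U \<in> proj_tensor M N" "V \<in> proj_tensor M N" "W \<in> proj_tensor M N"
  then obtain \<rho> \<sigma> \<tau> where in0: "\<rho> \<in> U" "\<sigma> \<in> V" "\<tau> \<in> W"
    by (metis proj_tensor_some_in)
  note lim = tensor_dist_tendsto_proj_tensor_dist
  have "tensor_dist M N (\<rho> n) (\<tau> n) \<le> tensor_dist M N (\<rho> n) (\<sigma> n) + tensor_dist M N (\<sigma> n) (\<tau> n)" for n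
    using UVW in0 proj_tensor_Cauchy[of _ M N]
    by (intro tensor_dist_triangle tensor_Cauchy_in_alg) auto
  then show "proj_tensor_dist M N U W \<le> proj_tensor_dist M N U V + proj_tensor_dist M N V W"
    by (intro LIMSEQ_le[OF lim[OF UVW(1,3) in0(1,3)]
          tendsto_add[OF lim[OF UVW(1,2) in0(1,2)] lim[OF UVW(2,3) in0(2,3)]]]) auto
qed

section \<open>Algebraic tensors inside the completion, and evaluation of forms there\<close>

lemma const_tensor_Cauchy: "u \<in> alg_tensor M N \<Longrightarrow> (\<lambda>_. u) \<in> tensor_Cauchy M N"
  by (simp add: tensor_Cauchy_def tensor_dist_self)

lemma
  assumes "u \<in> alg_tensor M N"
  shows proj_tensor_embed_in: "proj_tensor_embed M N u \<in> proj_tensor M N"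
    and const_in_proj_tensor_embed: "(\<lambda>_. u) \<in> proj_tensor_embed M N u"
  using const_tensor_Cauchy[OF assms] equiv_class_self[OF equiv_tensor_Cauchy_rel]
  by (auto simp: proj_tensor_embed_def proj_tensor_def intro: quotientI)

lemma proj_tensor_dist_embed:
  assumes "u \<in> alg_tensor M N" "v \<in> alg_tensor M N"
  shows "proj_tensor_dist M N (proj_tensor_embed M N u) (proj_tensor_embed M N v) = tensor_dist M N u v"
  using tensor_dist_tendsto_proj_tensor_dist[OF
      proj_tensor_embed_in[OF assms(1)] proj_tensor_embed_in[OF assms(2)]
      const_in_proj_tensor_embed[OF assms(1)] const_in_proj_tensor_embed[OF assms(2)]]
  by (simp add: LIMSEQ_const_iff)

lemma alg_tensor_dense:
  assumes "U \<in> proj_tensor M N" "0 < \<epsilon>"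
  obtains u where "u \<in> alg_tensor M N" "proj_tensor_dist M N U (proj_tensor_embed M N u) < \<epsilon>"
proof -
  obtain \<sigma> where \<sigma>: "\<sigma> \<in> U"
    by (metis assms(1) proj_tensor_some_in)
  then have C: "\<sigma> \<in> tensor_Cauchy M N"
    by (rule proj_tensor_Cauchy[OF assms(1)])
  have "0 < \<epsilon> / 2" using assms(2) by simp
  then obtain n0 where n0: "\<forall>m\<ge>n0. \<forall>n\<ge>n0. tensor_dist M N (\<sigma> m) (\<sigma> n) < \<epsilon> / 2"
    by (rule tensor_CauchyD[OF C])
  have alg: "\<sigma> n0 \<in> alg_tensor M N"
    using C by (rule tensor_Cauchy_in_alg)
  \<comment> \<open>Passing to the limit only preserves a weak inequality, hence the margin
    \<open>\<epsilon> / 2\<close>.\<close>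
  have "proj_tensor_dist M N U (proj_tensor_embed M N (\<sigma> n0)) \<le> \<epsilon> / 2"
    using n0 by (intro LIMSEQ_le_const2[OF tensor_dist_tendsto_proj_tensor_dist[OF assms(1)
        proj_tensor_embed_in[OF alg] \<sigma> const_in_proj_tensor_embed[OF alg]]]) (use less_imp_le in blast)
  then show ?thesis
    using that[OF alg] assms(2) by linarith
qed

lemma proj_tensor_norm_le:
  assumes "U \<in> proj_tensor M N" "u \<in> alg_tensor M N"
  shows "proj_tensor_norm M N U \<le> proj_norm M N u + proj_tensor_dist M N (proj_tensor_embed M N u) U"
proof -
  define \<sigma> where "\<sigma> = (SOME \<sigma>. \<sigma> \<in> U)"
  have \<sigma>: "\<sigma> \<in> U" "\<sigma> \<in> tensor_Cauchy M N"
    using proj_tensorD[OF assms(1)] by (auto simp: \<sigma>_def)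
  have "convergent (\<lambda>n. tensor_dist M N (\<sigma> n) (\<lambda>_. 0))"
    using convergent_tensor_dist[OF \<sigma>(2) const_tensor_Cauchy[OF alg_tensor_zero]] .
  then have "(\<lambda>n. proj_norm M N (\<sigma> n)) \<longlonglongrightarrow> proj_tensor_norm M N U"
    by (simp add: tensor_dist_zero_right proj_tensor_norm_def convergent_LIMSEQ_iff flip: \<sigma>_def)
  moreover have "(\<lambda>n. proj_norm M N u + tensor_dist M N u (\<sigma> n)) \<longlonglongrightarrow>
      proj_norm M N u + proj_tensor_dist M N (proj_tensor_embed M N u) U"
    by (intro tendsto_intros tensor_dist_tendsto_proj_tensor_dist proj_tensor_embed_in
        const_in_proj_tensor_embed assms \<sigma>)
  moreover have "proj_norm M N (\<sigma> n) \<le> proj_norm M N u + tensor_dist M N u (\<sigma> n)" for n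
    using tensor_dist_triangle[OF tensor_Cauchy_in_alg[OF \<sigma>(2)] assms(2) alg_tensor_zero, of n]
      tensor_dist_commute[OF tensor_Cauchy_in_alg[OF \<sigma>(2)] assms(2), of n]
    by (simp add: tensor_dist_zero_right)
  ultimately show ?thesis
    by (intro LIMSEQ_le) auto
qed

text \<open>The continuous extension of \<open>u \<mapsto> u \<beta>\<close> to the completion. It
  is meaningful for bounded forms, where the limit along the chosen representative exists.\<close>

definition proj_tensor_eval ::
  "('a, 'b, 'k::{real_normed_field,banach,second_countable_topology}) ptensor \<Rightarrow>
    (('a \<Rightarrow> 'k) \<Rightarrow> ('b \<Rightarrow> 'k) \<Rightarrow> 'k) \<Rightarrow> 'k" where
  "proj_tensor_eval U \<beta> = lim (\<lambda>n. (SOME \<sigma>. \<sigma> \<in> U) n \<beta>)"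

text \<open>Contractivity survives the passage to the limit. By density this estimate determines
  \<open>proj_tensor_eval\<close>, and it is the tool for bounding distances in the completion from
  below.\<close>

lemma norm_proj_tensor_eval_diff_le:
  assumes U: "U \<in> proj_tensor M N" and u: "u \<in> alg_tensor M N"
    and \<beta>: "\<beta> \<in> bounded_bilinear_forms M N"
  shows "norm (u \<beta> - proj_tensor_eval U \<beta>) \<le> proj_tensor_dist M N (proj_tensor_embed M N u) U"
proof -
  define \<sigma> where "\<sigma> = (SOME \<sigma>. \<sigma> \<in> U)"
  have \<sigma>: "\<sigma> \<in> U" "\<sigma> \<in> tensor_Cauchy M N"
    using proj_tensorD[OF U] by (auto simp: \<sigma>_def)
  have "convergent (\<lambda>n. \<sigma> n \<beta>)"
  proof (rule Cauchy_convergent, rule metric_CauchyI)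
    fix e :: real assume "0 < e"
    then obtain n0 where n0: "\<forall>m\<ge>n0. \<forall>n\<ge>n0. tensor_dist M N (\<sigma> m) (\<sigma> n) < e"
      by (rule tensor_CauchyD[OF \<sigma>(2)])
    have "dist (\<sigma> m \<beta>) (\<sigma> n \<beta>) < e" if "n0 \<le> m" "n0 \<le> n" for m n
      using norm_eval_diff_le_tensor_dist[OF tensor_Cauchy_in_alg[OF \<sigma>(2)] tensor_Cauchy_in_alg[OF \<sigma>(2)] \<beta>, of m n]
        n0 that by (fastforce simp: dist_norm)
    then show "\<exists>n0. \<forall>m\<ge>n0. \<forall>n\<ge>n0. dist (\<sigma> m \<beta>) (\<sigma> n \<beta>) < e"
      by blast
  qed
  then have "(\<lambda>n. \<sigma> n \<beta>) \<longlonglongrightarrow> proj_tensor_eval U \<beta>"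
    by (simp add: proj_tensor_eval_def convergent_LIMSEQ_iff flip: \<sigma>_def)
  then have "(\<lambda>n. norm (u \<beta> - \<sigma> n \<beta>)) \<longlonglongrightarrow> norm (u \<beta> - proj_tensor_eval U \<beta>)"
    by (intro tendsto_intros)
  moreover have "(\<lambda>n. tensor_dist M N u (\<sigma> n)) \<longlonglongrightarrow>
      proj_tensor_dist M N (proj_tensor_embed M N u) U"
    by (intro tensor_dist_tendsto_proj_tensor_dist proj_tensor_embed_in
        const_in_proj_tensor_embed u U \<sigma>)
  ultimately show ?thesis
    using norm_eval_diff_le_tensor_dist[OF u tensor_Cauchy_in_alg[OF \<sigma>(2)] \<beta>]
    by (intro LIMSEQ_le) auto
qed

text \<open>A ball contained in the closure of \<open>F\<close> would contain an embedded algebraic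
  tensor, by density; \<open>gap\<close> moves it, still inside the ball, to a point at positive
  distance from \<open>F\<close>, which is outside the closure. All perturbations can thus be made
  on finite sums, and \<open>r\<close> may depend on \<open>h\<close>.\<close>

lemma nowhere_dense_in_proj_tensor:
  assumes F: "F \<subseteq> proj_tensor M N"
    and gap: "\<And>g \<epsilon>. g \<in> alg_tensor M N \<Longrightarrow> 0 < \<epsilon> \<Longrightarrow>
      \<exists>h\<in>alg_tensor M N. tensor_dist M N g h < \<epsilon> \<and>
        (\<exists>r>0. \<forall>V\<in>F. r \<le> proj_tensor_dist M N (proj_tensor_embed M N h) V)"
  shows "nowhere_dense_in (proj_tensor_topology M N) F"
proof -
  interpret Metric_space "proj_tensor M N" "proj_tensor_dist M N"
    by (rule Metric_space_proj_tensor)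
  have "mtopology interior_of (mtopology closure_of F) = {}"
  proof (rule ccontr)
    assume "\<not> ?thesis"
    then obtain U where "U \<in> mtopology interior_of (mtopology closure_of F)"
      by blast
    then obtain e where U: "U \<in> proj_tensor M N" and "0 < e"
      and ball: "mball U e \<subseteq> mtopology closure_of F"
      unfolding in_interior_of_mball by blast
    then have e: "0 < e / 2" by simp
    obtain g where g: "g \<in> alg_tensor M N"
      "proj_tensor_dist M N U (proj_tensor_embed M N g) < e / 2"
      by (rule alg_tensor_dense[OF U e])
    obtain h r where h: "h \<in> alg_tensor M N" "tensor_dist M N g h < e / 2" and "0 < r"
      and r: "\<And>V. V \<in> F \<Longrightarrow> r \<le> proj_tensor_dist M N (proj_tensor_embed M N h) V"
      using gap[OF g(1) e] by blast
    have "proj_tensor_dist M N U (proj_tensor_embed M N h) < e"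
      using triangle[OF U proj_tensor_embed_in[OF g(1)] proj_tensor_embed_in[OF h(1)]]
        g h by (simp add: proj_tensor_dist_embed)
    then have "proj_tensor_embed M N h \<in> mtopology closure_of F"
      using ball U h(1) by (auto simp: proj_tensor_embed_in)
    then obtain V where "V \<in> F" "V \<in> mball (proj_tensor_embed M N h) r"
      using \<open>0 < r\<close> unfolding metric_closure_of by blast
    then show False
      using r by fastforce
  qed
  then show ?thesis
    using F by (simp add: nowhere_dense_in_def proj_tensor_topology_def)
qed

subsection \<open>Atomless measures\<close>

context finite_measure
begin

text \<open>A set that is not an atom contains a \<open>C\<close> of strictly intermediate measure,
  and the smaller of \<open>C\<close> and \<open>A - C\<close> has at most half the measure.\<close>

lemma atomless_split:
  assumes "atomless M" "A \<in> sets M" "0 < measure M A"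
  obtains B where "B \<in> sets M" "B \<subseteq> A" "0 < measure M B" "measure M B \<le> measure M A / 2"
proof -
  have "\<not> atom_of M A"
    using assms(1) by (simp add: atomless_def)
  then obtain C where C: "C \<in> sets M" "C \<subseteq> A" "measure M C \<noteq> 0" "measure M C \<noteq> measure M A"
    using assms(2,3) by (auto simp: atom_of_def emeasure_eq_measure)
  have "measure M C \<le> measure M A"
    using C assms by (intro finite_measure_mono) auto
  then have C': "0 < measure M C" "measure M C < measure M A"
    using C(3,4) by (auto simp: less_le)
  have D: "measure M (A - C) = measure M A - measure M C"
    using C assms by (intro finite_measure_Diff) auto
  show ?thesis
  proof (cases "measure M C \<le> measure M A / 2")
    case True
    then show ?thesis using that C C' by blast
  next
    case False
    then show ?thesis using that[of "A - C"] C C' D assms(2) by auto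
  qed
qed

lemma atomless_small_subset:
  assumes "atomless M" "A \<in> sets M" "0 < measure M A" "0 < \<epsilon>"
  obtains B where "B \<in> sets M" "B \<subseteq> A" "0 < measure M B" "measure M B < \<epsilon>"
proof -
  have *: "\<exists>B\<in>sets M. B \<subseteq> A \<and> 0 < measure M B \<and> measure M B \<le> measure M A / 2 ^ n" for n
  proof (induction n)
    case 0
    then show ?case using assms by auto
  next
    case (Suc n)
    then obtain B where B: "B \<in> sets M" "B \<subseteq> A" "0 < measure M B" "measure M B \<le> measure M A / 2 ^ n"
      by blast
    obtain C where C: "C \<in> sets M" "C \<subseteq> B" "0 < measure M C" "measure M C \<le> measure M B / 2"
      by (rule atomless_split[OF assms(1) B(1,3)])
    have "measure M C \<le> measure M A / 2 ^ Suc n"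
      using C(4) B(4) by simp
    then show ?case using B C by blast
  qed
  have "(\<lambda>n. measure M A * (1 / 2) ^ n) \<longlonglongrightarrow> measure M A * 0"
    by (intro tendsto_intros LIMSEQ_power_zero) auto
  then have "\<forall>\<^sub>F n in sequentially. measure M A * (1 / 2) ^ n < \<epsilon>"
    using assms(4) by (auto dest: order_tendstoD)
  then obtain n where "measure M A / 2 ^ n < \<epsilon>"
    by (auto simp: eventually_sequentially power_one_over)
  then show ?thesis
    using *[of n] that by fastforce
qed

text \<open>
  Sierpinski's theorem. Greedily add, at each step, a disjoint piece whose measure is at least half
  of the largest measure that still fits.
\<close>
lemma atomless_intermediate_value:
  assumes "atomless M" "A \<in> sets M" "0 \<le> t" "t \<le> measure M A"
  obtains B where "B \<in> sets M" "B \<subseteq> A" "measure M B = t"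
proof -
  \<comment> \<open>The candidates are the sets that can still be added to \<open>B\<close> inside
    \<open>A\<close> without exceeding the target \<open>t\<close>.\<close>
  define cand where "cand B = {C \<in> sets M. C \<subseteq> A - B \<and> measure M B + measure M C \<le> t}" for B
  have "\<exists>C\<in>cand B. \<forall>D\<in>cand B. measure M D \<le> 2 * measure M C" if B: "measure M B \<le> t" for B
  proof -
    let ?s = "Sup (measure M ` cand B)"
    have bdd: "bdd_above (measure M ` cand B)"
      by (rule bdd_aboveI[of _ "measure M (space M)"]) (auto intro: bounded_measure)
    have e: "{} \<in> cand B"
      using B by (simp add: cand_def)
    have le: "measure M D \<le> ?s" if "D \<in> cand B" for D
      using that bdd by (intro cSup_upper) auto
    show ?thesis
    proof (cases "?s = 0")
      case True
      then show ?thesis using e le by (intro bexI[of _ "{}"]) auto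
    next
      case False
      then have "?s / 2 < ?s"
        using le[OF e] by simp
      then obtain C where "C \<in> cand B" "?s / 2 < measure M C"
        using less_cSupD[of "measure M ` cand B" "?s / 2"] e by blast
      then show ?thesis using le by (intro bexI[of _ C]) force+
    qed
  qed
  then obtain G where G: "\<And>B. measure M B \<le> t \<Longrightarrow> G B \<in> cand B"
    "\<And>B D. measure M B \<le> t \<Longrightarrow> D \<in> cand B \<Longrightarrow> measure M D \<le> 2 * measure M (G B)"
    by metis
  define B where "B n = rec_nat {} (\<lambda>_ B. B \<union> G B) n" for n
  have B_simps: "B 0 = {}" "B (Suc n) = B n \<union> G (B n)" for n
    by (simp_all add: B_def)
  have B: "B n \<in> sets M \<and> B n \<subseteq> A \<and> measure M (B n) \<le> t" for n
  proof (induction n)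
    case 0
    then show ?case using assms(3) by (simp add: B_simps)
  next
    case (Suc n)
    then have g: "G (B n) \<in> cand (B n)" using G(1) by blast
    then have "measure M (B n \<union> G (B n)) = measure M (B n) + measure M (G (B n))"
      using Suc by (intro finite_measure_Union) (auto simp: cand_def)
    then show ?case using Suc g by (auto simp: B_simps cand_def)
  qed
  have diff: "measure M (G (B n)) = measure M (B (Suc n)) - measure M (B n)" for n
  proof -
    have g: "G (B n) \<in> cand (B n)" using G(1) B by blast
    then have "measure M (B n \<union> G (B n)) = measure M (B n) + measure M (G (B n))"
      using B[of n] by (intro finite_measure_Union) (auto simp: cand_def)
    then show ?thesis by (simp add: B_simps)
  qed
  have lim: "(\<lambda>n. measure M (B n)) \<longlonglongrightarrow> measure M (\<Union>n. B n)"
    using B by (intro finite_Lim_measure_incseq) (auto intro!: incseq_SucI simp: B_simps)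
  have Un: "(\<Union>n. B n) \<in> sets M" "(\<Union>n. B n) \<subseteq> A"
    using B by auto
  have le: "measure M (\<Union>n. B n) \<le> t"
    using B by (intro LIMSEQ_le_const2[OF lim]) auto
  \<comment> \<open>Were the target missed, a small set \<open>D\<close> left over would have been a
    candidate at every step. Every added piece would then have at least half the measure of
    \<open>D\<close>, although the increments of a convergent sequence tend to 0.\<close>
  have "\<not> measure M (\<Union>n. B n) < t"
  proof
    assume less: "measure M (\<Union>n. B n) < t"
    have "measure M (A - (\<Union>n. B n)) = measure M A - measure M (\<Union>n. B n)"
      using Un assms(2) by (intro finite_measure_Diff) auto
    then have pos: "0 < measure M (A - (\<Union>n. B n))"
      using less assms(4) by simp
    have "0 < t - measure M (\<Union>n. B n)" using less by simp
    then obtain D where D: "D \<in> sets M" "D \<subseteq> A - (\<Union>n. B n)" "0 < measure M D"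
      "measure M D < t - measure M (\<Union>n. B n)"
      using atomless_small_subset[OF assms(1) _ pos] Un assms(2) by (metis sets.Diff)
    have "measure M D \<le> 2 * measure M (G (B n))" for n
    proof (rule G(2))
      have "measure M (B n) \<le> measure M (\<Union>n. B n)"
        using Un by (intro finite_measure_mono) auto
      then show "D \<in> cand (B n)"
        using D by (auto simp: cand_def)
    qed (use B in auto)
    moreover have "(\<lambda>n. 2 * measure M (G (B n))) \<longlonglongrightarrow> 2 * (measure M (\<Union>n. B n) - measure M (\<Union>n. B n))"
      unfolding diff by (intro tendsto_intros LIMSEQ_Suc lim)
    ultimately have "measure M D \<le> 0"
      using LIMSEQ_le_const by fastforce
    then show False using D(3) by simp
  qed
  then show ?thesis
    using that[OF Un] le by simp
qed

text \<open>Peel off one piece of measure \<open>c\<close> at a time. The index set is an arbitrary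
  finite set so that pieces can be indexed by words as well as by numbers.\<close>

lemma atomless_equal_pieces:
  assumes "atomless M" "finite I" "A \<in> sets M" "0 \<le> c" "measure M A = real (card I) * c"
  obtains P where "\<And>i. i \<in> I \<Longrightarrow> P i \<in> sets M" "\<And>i. i \<in> I \<Longrightarrow> P i \<subseteq> A"
    "\<And>i. i \<in> I \<Longrightarrow> measure M (P i) = c" "disjoint_family_on P I"
proof -
  have "\<exists>P. (\<forall>i\<in>I. P i \<in> sets M \<and> P i \<subseteq> A \<and> measure M (P i) = c) \<and> disjoint_family_on P I"
    using assms(2,3,5)
  proof (induction I arbitrary: A rule: finite_induct)
    case empty
    then show ?case by (simp add: disjoint_family_on_def)
  next
    case (insert i I)
    then have m: "measure M A = real (card I) * c + c"
      by (simp add: algebra_simps)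
    have "c \<le> measure M A"
      unfolding m using assms(4) by simp
    then obtain B where B: "B \<in> sets M" "B \<subseteq> A" "measure M B = c"
      by (rule atomless_intermediate_value[OF assms(1) insert.prems(1) assms(4)])
    have "measure M (A - B) = real (card I) * c"
      using finite_measure_Diff[OF insert.prems(1) B(1,2)] m B(3) by simp
    then obtain P where P: "\<forall>i\<in>I. P i \<in> sets M \<and> P i \<subseteq> A - B \<and> measure M (P i) = c"
        "disjoint_family_on P I"
      using insert.IH[of "A - B"] insert.prems(1) B(1) by blast
    let ?P = "P(i := B)"
    have "\<forall>j\<in>insert i I. ?P j \<in> sets M \<and> ?P j \<subseteq> A \<and> measure M (?P j) = c"
      using P(1) B by auto
    moreover have "disjoint_family_on ?P (insert i I)"
      using P insert.hyps(2) by (fastforce simp: disjoint_family_on_def)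
    ultimately show ?case by blast
  qed
  then show ?thesis using that by metis
qed

text \<open>An averaging argument. Pieces meeting \<open>X\<close> in less than
  \<open>\<alpha> / (2 * card I)\<close> contribute at most \<open>\<alpha> / 2\<close> altogether;
  the remaining \<open>\<alpha> / 2\<close> must come from the other pieces, each of which
  contributes at most its own measure.\<close>

lemma card_pieces_ge:
  assumes "finite I" "I \<noteq> {}" "\<And>i. i \<in> I \<Longrightarrow> P i \<in> sets M" "disjoint_family_on P I"
    and "\<And>i. i \<in> I \<Longrightarrow> measure M (P i) = measure M (space M) / card I"
    and X: "X \<in> sets M" "\<alpha> \<le> measure M X" and "0 < \<alpha>"
  shows "\<alpha> / (2 * measure M (space M)) * card I \<le>
    card {i \<in> I. \<alpha> / (2 * card I) \<le> measure M (X \<inter> P i)}"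
proof -
  let ?J = "{i \<in> I. \<alpha> / (2 * card I) \<le> measure M (X \<inter> P i)}"
  let ?\<mu> = "measure M (space M)"
  have c: "0 < real (card I)"
    using assms(1,2) by (simp add: card_gt_0_iff)
  have "measure M X \<le> ?\<mu>"
    by (rule bounded_measure)
  then have \<mu>: "0 < ?\<mu>"
    using X(2) assms(8) by linarith
  have split: "measure M (P i) = measure M (X \<inter> P i) + measure M (P i - X)" if "i \<in> I" for i
    using finite_measure_Diff'[of "P i" X] assms(3)[OF that] X(1) by (simp add: Int_commute)
  \<comment> \<open>The pieces are not assumed to cover the space, only to have the right total
    measure. Estimating the parts outside \<open>X\<close> first shows that hardly anything of
    \<open>X\<close> can escape: the sum of \<open>measure M (X \<inter> P i)\<close> is at least
    \<open>measure M X\<close>.\<close>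
  have "(\<Sum>i\<in>I. measure M (P i - X)) = measure M (\<Union>i\<in>I. P i - X)"
    using assms(1,3,4) X(1)
    by (intro finite_measure_finite_Union[symmetric]) (auto simp: disjoint_family_on_def)
  also have "\<dots> \<le> measure M (space M - X)"
    using assms(3) X(1) sets.sets_into_space by (intro finite_measure_mono) blast+
  also have "\<dots> = ?\<mu> - measure M X"
    using X(1) by (simp add: finite_measure_compl)
  finally have "measure M X \<le> ?\<mu> - (\<Sum>i\<in>I. measure M (P i - X))"
    by simp
  also have "?\<mu> = (\<Sum>i\<in>I. measure M (P i))"
    using assms(5) c by simp
  also have "\<dots> - (\<Sum>i\<in>I. measure M (P i - X)) = (\<Sum>i\<in>I. measure M (X \<inter> P i))"
    using split by (simp add: sum.distrib)
  also have "\<dots> \<le> (\<Sum>i\<in>I. (if i \<in> ?J then ?\<mu> / card I else 0) + \<alpha> / (2 * card I))"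
  proof (rule sum_mono)
    fix i assume i: "i \<in> I"
    have "measure M (X \<inter> P i) \<le> ?\<mu> / card I"
      using split[OF i] assms(5)[OF i] measure_nonneg[of M "P i - X"] by linarith
    then show "measure M (X \<inter> P i) \<le> (if i \<in> ?J then ?\<mu> / card I else 0) + \<alpha> / (2 * card I)"
      using i assms(8) by (auto intro: add_increasing2)
  qed
  also have "\<dots> = card ?J * (?\<mu> / card I) + \<alpha> / 2"
    using assms(1,2) by (simp add: sum.distrib sum.If_cases Int_def conj_commute)
  finally have "\<alpha> / 2 \<le> card ?J * (?\<mu> / card I)"
    using X(2) by linarith
  then show ?thesis
    using c \<mu> by (simp add: field_simps)
qed

text \<open>Truncate \<open>f\<close> at a height \<open>n\<close> for which the part above costs
  less than \<open>\<epsilon> / 2\<close>; the truncated part contributes at most \<open>n\<close>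
  times the measure of \<open>A\<close>.\<close>

lemma integral_absolutely_continuous:
  fixes f :: "'a \<Rightarrow> real"
  assumes f: "integrable M f" "\<And>x. 0 \<le> f x" and "0 < \<epsilon>"
  obtains \<delta> where "0 < \<delta>" "\<And>A. A \<in> sets M \<Longrightarrow> measure M A < \<delta> \<Longrightarrow> (\<integral>x\<in>A. f x \<partial>M) < \<epsilon>"
proof -
  have int: "integrable M (\<lambda>x. min (f x) (real n))" for n
    using f by (intro Bochner_Integration.integrable_bound[OF f(1)]) auto
  have "(\<lambda>n. \<integral>x. min (f x) (real n) \<partial>M) \<longlonglongrightarrow> (\<integral>x. f x \<partial>M)"
  proof (rule integral_dominated_convergence[where w=f])
    have "(\<lambda>n. min (f x) (real n)) \<longlonglongrightarrow> f x" for x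
    proof (rule tendsto_eventually)
      show "\<forall>\<^sub>F n in sequentially. min (f x) (real n) = f x"
        using eventually_ge_at_top[of "nat \<lceil>f x\<rceil>"] by eventually_elim linarith
    qed
    then show "AE x in M. (\<lambda>n. min (f x) (real n)) \<longlonglongrightarrow> f x" by simp
  qed (use f int in auto)
  then have "\<forall>\<^sub>F n in sequentially. (\<integral>x. f x \<partial>M) - \<epsilon> / 2 < (\<integral>x. min (f x) (real n) \<partial>M)"
    using assms(3) by (intro order_tendstoD) auto
  then obtain n where n: "(\<integral>x. f x \<partial>M) - \<epsilon> / 2 < (\<integral>x. min (f x) (real n) \<partial>M)"
    by (auto simp: eventually_sequentially)
  show ?thesis
  proof (rule that)
    \<comment> \<open>The summand 1 covers the case \<open>n = 0\<close>.\<close>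
    show "0 < \<epsilon> / (2 * (real n + 1))"
      using assms(3) by simp
    fix A assume A: "A \<in> sets M" "measure M A < \<epsilon> / (2 * (real n + 1))"
    have "(\<integral>x\<in>A. f x \<partial>M) \<le> (\<integral>x. real n * indicator A x + (f x - min (f x) (real n)) \<partial>M)"
      unfolding set_lebesgue_integral_def
    proof (rule integral_mono)
      show "integrable M (\<lambda>x. indicator A x *\<^sub>R f x)"
        using A(1) f(1) by (rule integrable_mult_indicator)
      show "integrable M (\<lambda>x. real n * indicator A x + (f x - min (f x) (real n)))"
        using A(1) f(1) int
        by (intro Bochner_Integration.integrable_add Bochner_Integration.integrable_diff integrable_mult_right integrable_real_indicator) (auto simp: emeasure_eq_measure)
    qed (auto simp: indicator_def f(2))
    also have "\<dots> = real n * measure M A + ((\<integral>x. f x \<partial>M) - (\<integral>x. min (f x) (real n) \<partial>M))"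
      using A(1) f(1) int by (simp add: emeasure_eq_measure)
    also have "\<dots> < real n * measure M A + \<epsilon> / 2"
      using n by linarith
    also have "real n * measure M A \<le> (real n + 1) * measure M A"
      by (simp add: mult_right_mono)
    also have "\<dots> \<le> \<epsilon> / 2"
      using A(2) by (simp add: field_simps)
    finally show "(\<integral>x\<in>A. f x \<partial>M) < \<epsilon>"
      by simp
  qed
qed

end

text \<open>Almost every value of \<open>f\<close> lies in its essential range: an exceptional point
  lies in the preimage of a basic open set with null preimage, and there are only countably many of
  these.\<close>

lemma AE_emeasure_ball_neq_0:
  fixes f :: "'a \<Rightarrow> 'b::{metric_space, second_countable_topology}"
  assumes [measurable]: "f \<in> borel_measurable M"
  shows "AE s in M. \<forall>\<eta>>0. emeasure M {s' \<in> space M. dist (f s') (f s) < \<eta>} \<noteq> 0"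
proof -
  obtain \<B> :: "'b set set" where \<B>: "countable \<B>" "topological_basis \<B>"
    using ex_countable_basis by auto
  define \<N> where "\<N> = {V \<in> \<B>. emeasure M (f -` V \<inter> space M) = 0}"
  have meas: "f -` V \<inter> space M \<in> sets M" if "V \<in> \<B>" for V
    using topological_basis_open[OF \<B>(2) that] by measurable
  have null: "(\<Union>V\<in>\<N>. f -` V \<inter> space M) \<in> null_sets M"
    proof (rule null_sets_UN')
    show "countable \<N>"
      by (rule countable_subset[OF _ \<B>(1)]) (simp add: \<N>_def)
  qed (use meas in \<open>auto simp: \<N>_def null_sets_def\<close>)
  show ?thesis
  proof (rule AE_I'[OF null], rule subsetI)
    fix s assume "s \<in> {s \<in> space M. \<not> (\<forall>\<eta>>0. emeasure M {s' \<in> space M. dist (f s') (f s) < \<eta>} \<noteq> 0)}"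
    then obtain \<eta> where s: "s \<in> space M" and "0 < \<eta>"
      and zero: "emeasure M {s' \<in> space M. dist (f s') (f s) < \<eta>} = 0"
      by blast
    obtain V where V: "V \<in> \<B>" "f s \<in> V" "V \<subseteq> ball (f s) \<eta>"
      by (rule topological_basisE[OF \<B>(2), of "ball (f s) \<eta>" "f s"])
        (use \<open>0 < \<eta>\<close> in auto)
    have "emeasure M (f -` V \<inter> space M) \<le> emeasure M {s' \<in> space M. dist (f s') (f s) < \<eta>}"
      using V by (intro emeasure_mono) (auto simp: dist_commute)
    then have "V \<in> \<N>"
      using V(1) zero by (simp add: \<N>_def)
    then show "s \<in> (\<Union>V\<in>\<N>. f -` V \<inter> space M)"
      using V(2) s by blast
  qed
qed

text \<open>
  With \<open>M\<close> cut into \<open>m\<close> equal pieces and \<open>N\<close> into \<open>m ^ k\<close> equal pieces indexed by the words \<open>w\<close> of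
  length \<open>k\<close> over the \<open>m\<close> letters, \<open>C w\<close> is the union of the pieces of \<open>M\<close> whose letter occurs in
  \<open>w\<close>. Only a proportion \<open>(1 - a) ^ k\<close> of the words avoids a set of \<open>a * m\<close> letters.
\<close>
lemma exists_small_set_meeting_large_rectangles:
  fixes M :: "'a measure" and N :: "'b measure"
  assumes M: "finite_measure M" "atomless M" "0 < measure M (space M)"
    and N: "finite_measure N" "atomless N" "0 < measure N (space N)"
    and "0 < \<alpha>" "0 < \<delta>"
  obtains L :: "nat list set" and C :: "nat list \<Rightarrow> 'a set" and B :: "nat list \<Rightarrow> 'b set" and \<theta> :: real
  where "finite L" "\<And>j. j \<in> L \<Longrightarrow> C j \<in> sets M" "\<And>j. j \<in> L \<Longrightarrow> measure M (C j) < \<delta>"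
    "\<And>j. j \<in> L \<Longrightarrow> B j \<in> sets N" "disjoint_family_on B L" "0 < \<theta>"
    "\<And>X Y. X \<in> sets M \<Longrightarrow> Y \<in> sets N \<Longrightarrow> \<alpha> \<le> measure M X \<Longrightarrow> \<alpha> \<le> measure N Y \<Longrightarrow>
       \<exists>j\<in>L. \<theta> \<le> measure M (X \<inter> C j) \<and> \<theta> \<le> measure N (Y \<inter> B j)"
proof -
  interpret M: finite_measure M by fact
  interpret N: finite_measure N by fact
  let ?\<mu> = "measure M (space M)" and ?\<nu> = "measure N (space N)"
  \<comment> \<open>By \<open>card_pieces_ge\<close>, a set of measure at least
    \<open>\<alpha>\<close> meets at least the proportion \<open>a\<close> of equal pieces
    substantially, in \<open>M\<close> and in \<open>N\<close> alike.\<close>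
  define a where "a = min (1 / 2) (min (\<alpha> / (2 * ?\<mu>)) (\<alpha> / (2 * ?\<nu>)))"
  have a: "0 < a" "a < 1" "a \<le> \<alpha> / (2 * ?\<mu>)" "a \<le> \<alpha> / (2 * ?\<nu>)"
    using M(3) N(3) \<open>0 < \<alpha>\<close> by (auto simp: a_def)
  \<comment> \<open>The word length depends on \<open>a\<close> only: words avoiding a proportion
    \<open>a\<close> of the letters must be rarer than the proportion \<open>a\<close> of words that
    \<open>Y\<close> meets.\<close>
  obtain k where k: "(1 - a) ^ k < a"
    using real_arch_pow_inv[of a "1 - a"] a by auto
  \<comment> \<open>The number of letters is chosen after \<open>k\<close>: each \<open>C w\<close>
    consists of at most \<open>k\<close> pieces of measure \<open>?\<mu> / m\<close>, so a large
    \<open>m\<close> makes it smaller than \<open>\<delta>\<close>.\<close>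
  obtain m where m: "real k * ?\<mu> / \<delta> < real m"
    using reals_Archimedean2 by blast
  have "0 \<le> real k * ?\<mu> / \<delta>"
    using M(3) \<open>0 < \<delta>\<close> by simp
  then have m0: "0 < m"
    using m by linarith
  have small: "real k * (?\<mu> / m) < \<delta>"
    using m m0 \<open>0 < \<delta>\<close> by (simp add: field_simps)
  define L where "L = {w::nat list. set w \<subseteq> {..<m} \<and> length w = k}"
  have L: "finite L" "card L = m ^ k"
    by (simp_all add: L_def finite_lists_length_eq card_lists_length_eq)
  have L_pos: "0 < card L"
    using m0 by (simp add: L)
  obtain P where P: "\<And>i. i \<in> {..<m} \<Longrightarrow> P i \<in> sets M" "\<And>i. i \<in> {..<m} \<Longrightarrow> P i \<subseteq> space M"
      "\<And>i. i \<in> {..<m} \<Longrightarrow> measure M (P i) = ?\<mu> / m" "disjoint_family_on P {..<m}"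
    by (rule M.atomless_equal_pieces[of "{..<m}" "space M" "?\<mu> / m"]) (use M m0 in auto)
  obtain B where B: "\<And>j. j \<in> L \<Longrightarrow> B j \<in> sets N" "\<And>j. j \<in> L \<Longrightarrow> B j \<subseteq> space N"
      "\<And>j. j \<in> L \<Longrightarrow> measure N (B j) = ?\<nu> / card L" "disjoint_family_on B L"
    by (rule N.atomless_equal_pieces[of L "space N" "?\<nu> / card L"]) (use N L(1) L_pos in auto)
  define C where "C w = (\<Union>i\<in>set w. P i)" for w
  define \<theta> where "\<theta> = min (\<alpha> / (2 * m)) (\<alpha> / (2 * card L))"
  show ?thesis
  proof (rule that[of L C B \<theta>])
    show C_sets: "C j \<in> sets M" if "j \<in> L" for j
      using that P(1) by (auto simp: C_def L_def)
    show "measure M (C j) < \<delta>" if "j \<in> L" for j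
    proof -
      have "measure M (C j) \<le> (\<Sum>i\<in>set j. measure M (P i))"
        unfolding C_def using that P(1) by (intro measure_UNION_le) (auto simp: L_def)
      also have "\<dots> = real (card (set j)) * (?\<mu> / m)"
        using that P(3) by (simp add: L_def subset_iff)
      also have "\<dots> \<le> real k * (?\<mu> / m)"
        using that card_length[of j] M(3) by (intro mult_right_mono) (auto simp: L_def)
      finally show ?thesis using small by simp
    qed
    show "0 < \<theta>"
      using m0 L_pos \<open>0 < \<alpha>\<close> by (auto simp: \<theta>_def)
    fix X Y assume X: "X \<in> sets M" "\<alpha> \<le> measure M X" and Y: "Y \<in> sets N" "\<alpha> \<le> measure N Y"
    define I where "I = {i \<in> {..<m}. \<alpha> / (2 * m) \<le> measure M (X \<inter> P i)}"
    define J where "J = {j \<in> L. \<alpha> / (2 * card L) \<le> measure N (Y \<inter> B j)}"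
    have "\<alpha> / (2 * ?\<mu>) * m \<le> card I"
      using M.card_pieces_ge[of "{..<m}" P X \<alpha>] P m0 X \<open>0 < \<alpha>\<close> by (auto simp: I_def)
    then have cI: "a * m \<le> card I"
      using a(3) mult_right_mono[of a "\<alpha> / (2 * ?\<mu>)" "real m"] by linarith
    have "\<alpha> / (2 * ?\<nu>) * card L \<le> card J"
      using N.card_pieces_ge[of L B Y \<alpha>] B L(1) L_pos Y \<open>0 < \<alpha>\<close> by (auto simp: J_def card_gt_0_iff)
    then have cJ: "a * card L \<le> card J"
      using a(4) mult_right_mono[of a "\<alpha> / (2 * ?\<nu>)" "real (card L)"] by linarith
    \<comment> \<open>Counting: otherwise the words in \<open>J\<close> all avoid the letters in
      \<open>I\<close>, so there are at most \<open>(m * (1 - a)) ^ k\<close>, hence fewer than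
      \<open>a * card L\<close>, contradicting \<open>cJ\<close>.\<close>
    have "\<exists>j\<in>J. set j \<inter> I \<noteq> {}"
    proof (rule ccontr)
      assume "\<not> ?thesis"
      then have "J \<subseteq> {w. set w \<subseteq> {..<m} - I \<and> length w = k}"
        by (auto simp: J_def L_def)
      then have "card J \<le> card {w. set w \<subseteq> {..<m} - I \<and> length w = k}"
        by (intro card_mono finite_lists_length_eq) auto
      also have "\<dots> = card ({..<m} - I) ^ k"
        by (simp add: card_lists_length_eq)
      also have "card ({..<m} - I) = m - card I"
        by (subst card_Diff_subset) (auto simp: I_def)
      finally have "real (card J) \<le> real (m - card I) ^ k"
        by (metis of_nat_le_iff of_nat_power)
      also have "\<dots> \<le> (real m * (1 - a)) ^ k"
      proof (rule power_mono)
        have "card I \<le> card {..<m}"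
          by (intro card_mono) (auto simp: I_def)
        then show "real (m - card I) \<le> real m * (1 - a)"
          using cI by (simp add: of_nat_diff algebra_simps)
      qed simp
      also have "\<dots> = real (card L) * (1 - a) ^ k"
        by (simp add: L power_mult_distrib)
      also have "\<dots> < real (card L) * a"
        using k L_pos by (intro mult_strict_left_mono) auto
      finally show False
        using cJ by (simp add: mult.commute)
    qed
    then obtain j i where ji: "j \<in> J" "i \<in> set j" "i \<in> I"
      by blast
    have "\<theta> \<le> measure M (X \<inter> P i)"
      using ji(3) by (simp add: I_def \<theta>_def min_le_iff_disj)
    also have "\<dots> \<le> measure M (X \<inter> C j)"
      using ji X C_sets by (intro M.finite_measure_mono) (auto simp: C_def J_def)
    finally have "\<theta> \<le> measure M (X \<inter> C j)" .
    moreover have "\<theta> \<le> measure N (Y \<inter> B j)"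
      using ji(1) by (simp add: J_def \<theta>_def min_le_iff_disj)
    ultimately show "\<exists>j\<in>L. \<theta> \<le> measure M (X \<inter> C j) \<and> \<theta> \<le> measure N (Y \<inter> B j)"
      using ji(1) by (auto simp: J_def)
  qed (use L B in auto)
qed

subsection \<open>Merging terms on a small rectangle\<close>

text \<open>Under the identification of the tensor product with the integrable functions on the
  product space, this is integration over the rectangle \<open>A \<times> B\<close>.\<close>

definition rect_form ::
  "'a measure \<Rightarrow> 'b measure \<Rightarrow> 'a set \<Rightarrow> 'b set \<Rightarrow>
    ('a \<Rightarrow> 'k::{real_normed_field,banach,second_countable_topology}) \<Rightarrow> ('b \<Rightarrow> 'k) \<Rightarrow> 'k" where
  "rect_form M N A B x y = (\<integral>s\<in>A. x s \<partial>M) * (\<integral>t\<in>B. y t \<partial>N)"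

lemma norm_set_integral_le_L1_norm:
  assumes "integrable M x" "A \<in> sets M"
  shows "norm (\<integral>s\<in>A. x s \<partial>M) \<le> L1_norm M x"
proof -
  have "norm (\<integral>s. indicator A s *\<^sub>R x s \<partial>M) \<le> (\<integral>s. norm (indicator A s *\<^sub>R x s) \<partial>M)"
    by (rule integral_norm_bound)
  also have "\<dots> \<le> (\<integral>s. norm (x s) \<partial>M)"
    using assms integrable_mult_indicator[OF assms(2,1)]
    by (intro integral_mono integrable_norm) (auto simp: indicator_def)
  finally show ?thesis
    by (simp add: set_lebesgue_integral_def L1_norm_def)
qed

lemma rect_form_in_bilinear_forms:
  fixes M :: "'a measure" and N :: "'b measure"
  assumes "A \<in> sets M" "B \<in> sets N"
  shows "(rect_form M N A B :: ('a \<Rightarrow> 'k::{real_normed_field,banach,second_countable_topology}) \<Rightarrow> _)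
    \<in> bilinear_forms M N"
proof -
  have intM: "set_integrable M A f" if "integrable M f" for f :: "'a \<Rightarrow> 'k"
    unfolding set_integrable_def using assms(1) that by (rule integrable_mult_indicator)
  have intN: "set_integrable N B f" if "integrable N f" for f :: "'b \<Rightarrow> 'k"
    unfolding set_integrable_def using assms(2) that by (rule integrable_mult_indicator)
  have congM: "(\<integral>s\<in>A. f s \<partial>M) = (\<integral>s\<in>A. g s \<partial>M)"
    if "integrable M f" "integrable M g" "AE s in M. f s = g s" for f g :: "'a \<Rightarrow> 'k"
    unfolding set_lebesgue_integral_def
    using that assms by (intro integral_cong_AE borel_measurable_scaleR borel_measurable_indicator) auto
  have congN: "(\<integral>s\<in>B. f s \<partial>N) = (\<integral>s\<in>B. g s \<partial>N)"
    if "integrable N f" "integrable N g" "AE s in N. f s = g s" for f g :: "'b \<Rightarrow> 'k"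
    unfolding set_lebesgue_integral_def
    using that assms by (intro integral_cong_AE borel_measurable_scaleR borel_measurable_indicator) auto
  show ?thesis
    unfolding bilinear_forms_def mem_Collect_eq L1_iff rect_form_def
  proof (intro conjI ballI allI impI)
    fix x x' :: "'a \<Rightarrow> 'k" and y :: "'b \<Rightarrow> 'k"
    assume "x \<in> L1 M" "x' \<in> L1 M"
    then show "(\<integral>s\<in>A. x s + x' s \<partial>M) * (\<integral>t\<in>B. y t \<partial>N) =
        (\<integral>s\<in>A. x s \<partial>M) * (\<integral>t\<in>B. y t \<partial>N) + (\<integral>s\<in>A. x' s \<partial>M) * (\<integral>t\<in>B. y t \<partial>N)"
      using intM by (simp add: set_integral_add distrib_right)
  next
    fix x :: "'a \<Rightarrow> 'k" and y y' :: "'b \<Rightarrow> 'k"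
    assume "y \<in> L1 N" "y' \<in> L1 N"
    then show "(\<integral>s\<in>A. x s \<partial>M) * (\<integral>t\<in>B. y t + y' t \<partial>N) =
        (\<integral>s\<in>A. x s \<partial>M) * (\<integral>t\<in>B. y t \<partial>N) + (\<integral>s\<in>A. x s \<partial>M) * (\<integral>t\<in>B. y' t \<partial>N)"
      using intN by (simp add: set_integral_add distrib_left)
  next
    fix x x' :: "'a \<Rightarrow> 'k" and y :: "'b \<Rightarrow> 'k"
    assume "x \<in> L1 M" "x' \<in> L1 M" "AE s in M. x s = x' s"
    then show "(\<integral>s\<in>A. x s \<partial>M) * (\<integral>t\<in>B. y t \<partial>N) = (\<integral>s\<in>A. x' s \<partial>M) * (\<integral>t\<in>B. y t \<partial>N)"
      using congM[of x x'] by simp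
  next
    fix x :: "'a \<Rightarrow> 'k" and y y' :: "'b \<Rightarrow> 'k"
    assume "y \<in> L1 N" "y' \<in> L1 N" "AE t in N. y t = y' t"
    then show "(\<integral>s\<in>A. x s \<partial>M) * (\<integral>t\<in>B. y t \<partial>N) = (\<integral>s\<in>A. x s \<partial>M) * (\<integral>t\<in>B. y' t \<partial>N)"
      using congN[of y y'] by simp
  qed (simp_all add: mult_ac)
qed

lemma rect_form_in_bounded_bilinear_forms:
  fixes M :: "'a measure" and N :: "'b measure"
  assumes "A \<in> sets M" "B \<in> sets N"
  shows "(rect_form M N A B :: ('a \<Rightarrow> 'k::{real_normed_field,banach,second_countable_topology}) \<Rightarrow> _)
    \<in> bounded_bilinear_forms M N"
proof -
  have "norm (rect_form M N A B x y) \<le> L1_norm M x * L1_norm N y"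
    if "integrable M x" "integrable N y" for x :: "'a \<Rightarrow> 'k" and y :: "'b \<Rightarrow> 'k"
    unfolding rect_form_def norm_mult
    using that assms by (intro mult_mono norm_set_integral_le_L1_norm) simp_all
  then show ?thesis
    using rect_form_in_bilinear_forms[OF assms] by (simp add: bounded_bilinear_forms_def)
qed

section \<open>Norms of restrictions, and functions that are nearly constant on a set\<close>

lemma (in finite_measure) has_bochner_integral_indicator_const:
  fixes c :: "'k::{banach,second_countable_topology}"
  assumes "A \<in> sets M"
  shows "has_bochner_integral M (\<lambda>s. indicator A s *\<^sub>R c) (measure M A *\<^sub>R c)"
  using assms by (intro has_bochner_integral_indicator) (auto simp: emeasure_eq_measure)

lemma (in finite_measure) integrable_indicator_const:
  fixes c :: "'k::{banach,second_countable_topology}"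
  assumes "A \<in> sets M"
  shows "integrable M (\<lambda>s. indicator A s *\<^sub>R c)"
  using has_bochner_integral_indicator_const[OF assms] by (rule integrable.intros)

lemma (in finite_measure) L1_norm_indicator_const:
  assumes "A \<in> sets M"
  shows "L1_norm M (\<lambda>s. indicator A s *\<^sub>R c) = norm c * measure M A"
proof -
  have "norm (indicator A s *\<^sub>R c) = indicator A s *\<^sub>R norm c" for s
    by (simp add: indicator_def)
  then show ?thesis
    using has_bochner_integral_integral_eq[OF has_bochner_integral_indicator_const[OF assms, of "norm c"]]
    by (simp add: L1_norm_def mult.commute)
qed

text \<open>The additivity of the norm on disjointly supported functions. It is why splitting a
  factor along a set adds nothing to the cost of a term.\<close>

lemma L1_norm_minus_restriction:
  assumes "integrable M x" "A \<in> sets M"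
  shows "L1_norm M (\<lambda>s. x s - indicator A s *\<^sub>R x s) = L1_norm M x - L1_norm M (\<lambda>s. indicator A s *\<^sub>R x s)"
proof -
  have "L1_norm M (\<lambda>s. x s - indicator A s *\<^sub>R x s) =
      (\<integral>s. norm (x s) - norm (indicator A s *\<^sub>R x s) \<partial>M)"
    unfolding L1_norm_def by (rule Bochner_Integration.integral_cong) (auto simp: indicator_def)
  also have "\<dots> = L1_norm M x - L1_norm M (\<lambda>s. indicator A s *\<^sub>R x s)"
    unfolding L1_norm_def using assms(1) integrable_mult_indicator[OF assms(2,1)]
    by (intro Bochner_Integration.integral_diff integrable_norm)
  finally show ?thesis .
qed

lemma L1_norm_add_le:
  assumes "integrable M x" "integrable M x'"
  shows "L1_norm M (\<lambda>s. x s + x' s) \<le> L1_norm M x + L1_norm M x'"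
proof -
  have "L1_norm M (\<lambda>s. x s + x' s) \<le> (\<integral>s. norm (x s) + norm (x' s) \<partial>M)"
    unfolding L1_norm_def using assms
    by (intro integral_mono Bochner_Integration.integrable_add integrable_norm norm_triangle_ineq)
  then show ?thesis
    using assms by (simp add: L1_norm_def)
qed

lemma (in finite_measure)
  fixes x :: "'a \<Rightarrow> 'k::{real_normed_field,banach,second_countable_topology}"
  assumes x: "integrable M x" and A: "A \<in> sets M"
    and near: "\<And>s. s \<in> A \<Longrightarrow> norm (x s - a) \<le> \<eta>"
  shows L1_norm_near_const: "L1_norm M (\<lambda>s. indicator A s *\<^sub>R (x s - a)) \<le> \<eta> * measure M A"
    and L1_norm_restriction_le: "L1_norm M (\<lambda>s. indicator A s *\<^sub>R x s) \<le> (norm a + \<eta>) * measure M A"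
    and L1_norm_restriction_ge: "norm a * measure M A \<le> L1_norm M (\<lambda>s. indicator A s *\<^sub>R x s) + \<eta> * measure M A"
proof -
  have int: "integrable M (\<lambda>s. indicator A s *\<^sub>R (x s - a))"
    unfolding scaleR_diff_right
    by (intro Bochner_Integration.integrable_diff integrable_mult_indicator x A integrable_indicator_const)
  have "L1_norm M (\<lambda>s. indicator A s *\<^sub>R (x s - a)) \<le> (\<integral>s. indicator A s *\<^sub>R \<eta> \<partial>M)"
    unfolding L1_norm_def
    by (rule integral_mono[OF integrable_norm[OF int] integrable_indicator_const[OF A]])
      (use near in \<open>simp add: indicator_def\<close>)
  also have "\<dots> = \<eta> * measure M A"
    using has_bochner_integral_integral_eq[OF has_bochner_integral_indicator_const[OF A, of \<eta>]]
    by (simp only: real_scaleR_def mult.commute)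
  finally show 1: "L1_norm M (\<lambda>s. indicator A s *\<^sub>R (x s - a)) \<le> \<eta> * measure M A" .
  note c = L1_norm_indicator_const[OF A, of a] integrable_indicator_const[OF A, of a]
  have "L1_norm M (\<lambda>s. indicator A s *\<^sub>R x s) \<le>
      L1_norm M (\<lambda>s. indicator A s *\<^sub>R (x s - a)) + L1_norm M (\<lambda>s. indicator A s *\<^sub>R a)"
    using L1_norm_add_le[OF int c(2)] by (simp add: scaleR_diff_right)
  then show "L1_norm M (\<lambda>s. indicator A s *\<^sub>R x s) \<le> (norm a + \<eta>) * measure M A"
    using 1 unfolding c by (simp add: algebra_simps)
  have "L1_norm M (\<lambda>s. indicator A s *\<^sub>R a) \<le>
      L1_norm M (\<lambda>s. indicator A s *\<^sub>R x s) + L1_norm M (\<lambda>s. - (indicator A s *\<^sub>R (x s - a)))"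
    using L1_norm_add_le[OF integrable_mult_indicator[OF A x] Bochner_Integration.integrable_minus[OF int]]
    by (simp add: scaleR_diff_right)
  also have "L1_norm M (\<lambda>s. - (indicator A s *\<^sub>R (x s - a))) = L1_norm M (\<lambda>s. indicator A s *\<^sub>R (x s - a))"
    by (simp only: L1_norm_def norm_minus_cancel)
  finally show "norm a * measure M A \<le> L1_norm M (\<lambda>s. indicator A s *\<^sub>R x s) + \<eta> * measure M A"
    using 1 unfolding c by linarith
qed

text \<open>The constant part on \<open>A \<times> B\<close> can be cut out of a term almost for
  free: the cost of what remains drops by the full cost of the part removed, up to an error of order
  \<open>\<eta>\<close> times the measure of the rectangle. The error has to be proportional to that
  measure, since the rectangle shrinks with \<open>\<eta>\<close>.\<close>

lemma elem_tensor_near_const: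
  fixes x :: "'a \<Rightarrow> 'k::{real_normed_field,banach,second_countable_topology}"
  assumes M: "finite_measure M" and N: "finite_measure N"
    and x: "integrable M x" and y: "integrable N y" and A: "A \<in> sets M" and B: "B \<in> sets N"
    and nx: "\<And>s. s \<in> A \<Longrightarrow> norm (x s - a) \<le> \<eta>" and ny: "\<And>t. t \<in> B \<Longrightarrow> norm (y t - b) \<le> \<eta>"
    and \<eta>: "0 \<le> \<eta>" "\<eta> \<le> 1"
  obtains R where "R \<in> alg_tensor M N"
    "\<And>\<beta>. elem_tensor M N x y \<beta> =
      elem_tensor M N (\<lambda>s. indicator A s *\<^sub>R a) (\<lambda>t. indicator B t *\<^sub>R b) \<beta> + R \<beta>"
    "proj_norm M N R \<le> L1_norm M x * L1_norm N y - norm (a * b) * (measure M A * measure N B)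
      + 2 * \<eta> * (norm a + norm b + 1) * (measure M A * measure N B)"
proof -
  interpret M: finite_measure M by fact
  interpret N: finite_measure N by fact
  let ?p = "measure M A" and ?q = "measure N B"
  define xA x' dx where "xA = (\<lambda>s. indicator A s *\<^sub>R x s)" and "x' = (\<lambda>s. x s - indicator A s *\<^sub>R x s)"
    and "dx = (\<lambda>s. indicator A s *\<^sub>R (x s - a))"
  define yB y' dy where "yB = (\<lambda>t. indicator B t *\<^sub>R y t)" and "y' = (\<lambda>t. y t - indicator B t *\<^sub>R y t)"
    and "dy = (\<lambda>t. indicator B t *\<^sub>R (y t - b))"
  let ?a = "\<lambda>s. indicator A s *\<^sub>R a" and ?b = "\<lambda>t. indicator B t *\<^sub>R b"
  note ia = M.integrable_indicator_const[OF A, of a] and ib = N.integrable_indicator_const[OF B, of b]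
  have ixA: "integrable M xA" and iyB: "integrable N yB"
    unfolding xA_def yB_def using A B x y integrable_mult_indicator by blast+
  have ix': "integrable M x'" and iy': "integrable N y'"
    unfolding x'_def y'_def using ixA iyB x y
    by (auto simp: xA_def yB_def intro!: Bochner_Integration.integrable_diff)
  have idx: "integrable M dx" and idy: "integrable N dy"
    unfolding dx_def dy_def scaleR_diff_right using ixA iyB ia ib
    by (auto simp: xA_def yB_def intro!: Bochner_Integration.integrable_diff)
  \<comment> \<open>The first two summands correct the constants \<open>a\<close> and
    \<open>b\<close> on \<open>A \<times> B\<close>; the last two are the part outside, first over
    \<open>A\<close> and then over its complement. By additivity of the norm the outside part costs
    at most \<open>L1_norm M x * L1_norm N y - X * Y\<close>.\<close>
  define R where "R = (\<lambda>\<beta>. (elem_tensor M N dx ?b \<beta> + elem_tensor M N xA dy \<beta>) +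
      (elem_tensor M N xA y' \<beta> + elem_tensor M N x' y \<beta>))"
  note in_alg = elem_tensor_in_alg_tensor[OF idx ib] elem_tensor_in_alg_tensor[OF ixA idy]
    elem_tensor_in_alg_tensor[OF ixA iy'] elem_tensor_in_alg_tensor[OF ix' y]
  show ?thesis
  proof (rule that[of R])
    show "R \<in> alg_tensor M N"
      unfolding R_def by (intro alg_tensor_add in_alg)
  next
    fix \<beta>
    have "elem_tensor M N x y \<beta> = elem_tensor M N xA y \<beta> + elem_tensor M N x' y \<beta>"
      using elem_tensor_add_left[OF ixA ix' y, of \<beta>] by (simp add: xA_def x'_def)
    moreover have "elem_tensor M N xA y \<beta> = elem_tensor M N xA yB \<beta> + elem_tensor M N xA y' \<beta>"
      using elem_tensor_add_right[OF ixA iyB iy', of \<beta>] by (simp add: yB_def y'_def)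
    moreover have "elem_tensor M N xA yB \<beta> = elem_tensor M N xA ?b \<beta> + elem_tensor M N xA dy \<beta>"
      using elem_tensor_add_right[OF ixA ib idy, of \<beta>] by (simp add: yB_def dy_def scaleR_diff_right)
    moreover have "elem_tensor M N xA ?b \<beta> = elem_tensor M N ?a ?b \<beta> + elem_tensor M N dx ?b \<beta>"
      using elem_tensor_add_left[OF ia idx ib, of \<beta>] by (simp add: xA_def dx_def scaleR_diff_right)
    ultimately show "elem_tensor M N x y \<beta> = elem_tensor M N ?a ?b \<beta> + R \<beta>"
      by (simp add: R_def)
  next
    define X Y where "X = L1_norm M xA" and "Y = L1_norm N yB"
    have X: "0 \<le> X" "X \<le> (norm a + \<eta>) * ?p" "norm a * ?p \<le> X + \<eta> * ?p"
      and dx: "L1_norm M dx \<le> \<eta> * ?p"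
      using M.L1_norm_restriction_le[OF x A nx] M.L1_norm_restriction_ge[OF x A nx]
        M.L1_norm_near_const[OF x A nx] by (auto simp: X_def xA_def dx_def)
    have Y: "0 \<le> Y" "norm b * ?q \<le> Y + \<eta> * ?q" and dy: "L1_norm N dy \<le> \<eta> * ?q"
      using N.L1_norm_restriction_ge[OF y B ny]
        N.L1_norm_near_const[OF y B ny] by (auto simp: Y_def yB_def dy_def)
    have b: "L1_norm N ?b = norm b * ?q"
      by (rule N.L1_norm_indicator_const[OF B])
    have x': "L1_norm M x' = L1_norm M x - X" and y': "L1_norm N y' = L1_norm N y - Y"
      using L1_norm_minus_restriction[OF x A] L1_norm_minus_restriction[OF y B]
      by (auto simp: x'_def y'_def X_def Y_def xA_def yB_def)
    have "proj_norm M N R \<le>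
        (proj_norm M N (elem_tensor M N dx ?b) + proj_norm M N (elem_tensor M N xA dy)) +
        (proj_norm M N (elem_tensor M N xA y') + proj_norm M N (elem_tensor M N x' y))"
      unfolding R_def
      by (rule order_trans[OF proj_norm_add_le]; (intro add_mono proj_norm_add_le alg_tensor_add in_alg)?)
    also have "\<dots> \<le> (L1_norm M dx * (norm b * ?q) + X * L1_norm N dy) +
        (X * (L1_norm N y - Y) + (L1_norm M x - X) * L1_norm N y)"
      unfolding b[symmetric] x'[symmetric] y'[symmetric] unfolding X_def
      by (intro add_mono proj_norm_elem_tensor_le idx ib ixA idy iy' ix' y)
    also have "\<dots> \<le> (\<eta> * ?p * (norm b * ?q) + X * (\<eta> * ?q)) + (L1_norm M x * L1_norm N y - X * Y)"
      using mult_right_mono[OF dx, of "norm b * ?q"] mult_left_mono[OF dy X(1)]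
      by (simp add: algebra_simps)
    \<comment> \<open>Each correction enters twice, once as a cost of its own and once when
      \<open>X * Y\<close> is replaced by the product for the constants. This is the origin of the
      factor 2; the summand 1 bounds \<open>\<eta>\<close> in
      \<open>X \<le> (norm a + \<eta>) * ?p\<close>.\<close>
    also have "\<dots> \<le> L1_norm M x * L1_norm N y - norm (a * b) * (?p * ?q)
        + 2 * \<eta> * (norm a + norm b + 1) * (?p * ?q)"
    proof -
      have "norm a * ?p * (norm b * ?q) \<le> (X + \<eta> * ?p) * (norm b * ?q)"
        using X(3) by (intro mult_right_mono) auto
      moreover have "X * (norm b * ?q) \<le> X * (Y + \<eta> * ?q)"
        using Y(2) X(1) by (rule mult_left_mono)
      moreover have "X * (\<eta> * ?q) \<le> (norm a + 1) * ?p * (\<eta> * ?q)"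
      proof (rule mult_right_mono)
        have "(norm a + \<eta>) * ?p \<le> (norm a + 1) * ?p"
          using \<eta>(2) by (intro mult_right_mono) auto
        then show "X \<le> (norm a + 1) * ?p"
          using X(2) by linarith
      qed (use \<eta>(1) in simp)
      ultimately show ?thesis
        by (simp add: algebra_simps norm_mult)
    qed
    finally show "proj_norm M N R \<le> L1_norm M x * L1_norm N y - norm (a * b) * (?p * ?q)
      + 2 * \<eta> * (norm a + norm b + 1) * (?p * ?q)" .
  qed
qed

text \<open>
  If the two terms were not aligned at \<open>(s, t)\<close>, then near this point both would be almost
  constant on a rectangle of positive measure, and merging them there would lower the norm.
\<close>
lemma norm_add_eq_of_proj_norm_ge:
  fixes x x' :: "'a \<Rightarrow> 'k::{real_normed_field,banach,second_countable_topology}"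
  assumes M: "finite_measure M" and N: "finite_measure N"
    and x: "integrable M x" "integrable M x'" and y: "integrable N y" "integrable N y'"
    and ge: "L1_norm M x * L1_norm N y + L1_norm M x' * L1_norm N y' \<le>
      proj_norm M N (\<lambda>\<beta>. elem_tensor M N x y \<beta> + elem_tensor M N x' y' \<beta>)"
    and s: "\<forall>\<eta>>0. emeasure M {s' \<in> space M. dist (x s', x' s') (x s, x' s) < \<eta>} \<noteq> 0"
    and t: "\<forall>\<eta>>0. emeasure N {t' \<in> space N. dist (y t', y' t') (y t, y' t) < \<eta>} \<noteq> 0"
  shows "norm (x s * y t + x' s * y' t) = norm (x s * y t) + norm (x' s * y' t)"
proof (rule ccontr)
  interpret M: finite_measure M by fact
  interpret N: finite_measure N by fact
  define c where "c = x s * y t + x' s * y' t"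
  \<comment> \<open>The saving, per unit of measure of the rectangle, from merging the two constant
    parts into one.\<close>
  define \<gamma> where "\<gamma> = norm (x s * y t) + norm (x' s * y' t) - norm c"
  define K where "K = norm (x s) + norm (y t) + norm (x' s) + norm (y' t) + 1"
  assume "\<not> ?thesis"
  then have \<gamma>: "0 < \<gamma>"
    using norm_triangle_ineq[of "x s * y t" "x' s * y' t"] by (simp add: \<gamma>_def c_def)
  have K: "1 \<le> K"
    by (simp add: K_def)
  \<comment> \<open>The two remainders have a total error of \<open>2 * \<eta> * (K + 1)\<close> per
    unit of measure. This is at most \<open>4 * \<eta> * K\<close>, hence at most
    \<open>\<gamma> / 2\<close>, which is less than the saving.\<close>
  define \<eta> where "\<eta> = min 1 (\<gamma> / (8 * K))"
  have \<eta>: "0 < \<eta>" "\<eta> \<le> 1" "\<eta> \<le> \<gamma> / (8 * K)"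
    using \<gamma> K by (auto simp: \<eta>_def)
  have "\<eta> * K \<le> \<gamma> / (8 * K) * K"
    using \<eta>(3) K by (intro mult_right_mono) auto
  then have \<eta>K: "\<eta> * K \<le> \<gamma> / 8"
    using K by simp
  \<comment> \<open>The ball is taken around a pair of values so that one set of positive measure
    makes both functions nearly constant.\<close>
  define A where "A = {s' \<in> space M. dist (x s', x' s') (x s, x' s) < \<eta>}"
  define B where "B = {t' \<in> space N. dist (y t', y' t') (y t, y' t) < \<eta>}"
  have [measurable]: "x \<in> borel_measurable M" "x' \<in> borel_measurable M"
    "y \<in> borel_measurable N" "y' \<in> borel_measurable N"
    using x y by auto
  have A: "A \<in> sets M" and B: "B \<in> sets N"
    unfolding A_def B_def by measurable
  let ?p = "measure M A" and ?q = "measure N B"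
  have "emeasure M A \<noteq> 0" "emeasure N B \<noteq> 0"
    using s t \<eta>(1) unfolding A_def B_def by blast+
  then have pq: "0 < ?p * ?q"
    by (simp add: M.emeasure_eq_measure N.emeasure_eq_measure zero_less_measure_iff)
  have near: "norm (x s' - x s) \<le> \<eta>" "norm (x' s' - x' s) \<le> \<eta>" if "s' \<in> A" for s'
    using that dist_fst_le[of "(x s', x' s')" "(x s, x' s)"] dist_snd_le[of "(x s', x' s')" "(x s, x' s)"]
    by (auto simp: A_def dist_norm)
  have near': "norm (y t' - y t) \<le> \<eta>" "norm (y' t' - y' t) \<le> \<eta>" if "t' \<in> B" for t'
    using that dist_fst_le[of "(y t', y' t')" "(y t, y' t)"] dist_snd_le[of "(y t', y' t')" "(y t, y' t)"]
    by (auto simp: B_def dist_norm)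
  have "0 \<le> \<eta>" using \<eta>(1) by simp
  obtain R where R: "R \<in> alg_tensor M N" "\<And>\<beta>. elem_tensor M N x y \<beta> =
      elem_tensor M N (\<lambda>u. indicator A u *\<^sub>R x s) (\<lambda>u. indicator B u *\<^sub>R y t) \<beta> + R \<beta>"
    "proj_norm M N R \<le> L1_norm M x * L1_norm N y - norm (x s * y t) * (?p * ?q)
      + 2 * \<eta> * (norm (x s) + norm (y t) + 1) * (?p * ?q)"
    using elem_tensor_near_const[OF M N x(1) y(1) A B near(1) near'(1) \<open>0 \<le> \<eta>\<close> \<eta>(2)] by blast
  obtain R' where R': "R' \<in> alg_tensor M N" "\<And>\<beta>. elem_tensor M N x' y' \<beta> =
      elem_tensor M N (\<lambda>u. indicator A u *\<^sub>R x' s) (\<lambda>u. indicator B u *\<^sub>R y' t) \<beta> + R' \<beta>"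
    "proj_norm M N R' \<le> L1_norm M x' * L1_norm N y' - norm (x' s * y' t) * (?p * ?q)
      + 2 * \<eta> * (norm (x' s) + norm (y' t) + 1) * (?p * ?q)"
    using elem_tensor_near_const[OF M N x(2) y(2) A B near(2) near'(2) \<open>0 \<le> \<eta>\<close> \<eta>(2)] by blast
  note i1 = M.integrable_indicator_const[OF A] N.integrable_indicator_const[OF B]
  let ?E = "elem_tensor M N (\<lambda>u. indicator A u *\<^sub>R 1) (\<lambda>u. indicator B u *\<^sub>R (1::'k))"
  let ?S = "elem_tensor M N (\<lambda>u. indicator A u *\<^sub>R c) (\<lambda>u. indicator B u *\<^sub>R (1::'k))"
  \<comment> \<open>All constant tensors on the rectangle are multiples of the single tensor
    \<open>?E\<close>, so the two constant parts add up to \<open>?S\<close>, of cost at most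
    \<open>norm c\<close> instead of the sum of the two norms.\<close>
  have const: "elem_tensor M N (\<lambda>u. indicator A u *\<^sub>R a) (\<lambda>u. indicator B u *\<^sub>R b) \<beta> =
      a * b * ?E \<beta>" for a b :: 'k and \<beta>
    using elem_tensor_scale_left[OF i1(1)[of "1::'k"] i1(2)[of b], of a \<beta>]
      elem_tensor_scale_right[OF i1(1)[of "1::'k"] i1(2)[of 1], of b \<beta>] by simp
  have S: "elem_tensor M N x y \<beta> + elem_tensor M N x' y' \<beta> = ?S \<beta> + (R \<beta> + R' \<beta>)" for \<beta>
    unfolding R(2) R'(2) const[of c 1] const[of "x s"] const[of "x' s"] by (simp add: c_def algebra_simps)
  have S_alg: "?S \<in> alg_tensor M N"
    by (intro elem_tensor_in_alg_tensor i1)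
  have "proj_norm M N (\<lambda>\<beta>. elem_tensor M N x y \<beta> + elem_tensor M N x' y' \<beta>) \<le>
      proj_norm M N ?S + proj_norm M N (\<lambda>\<beta>. R \<beta> + R' \<beta>)"
    unfolding S by (intro proj_norm_add_le S_alg alg_tensor_add R(1) R'(1))
  also have "proj_norm M N (\<lambda>\<beta>. R \<beta> + R' \<beta>) \<le> proj_norm M N R + proj_norm M N R'"
    by (intro proj_norm_add_le R(1) R'(1))
  also have "proj_norm M N ?S \<le> norm c * (?p * ?q)"
    using proj_norm_elem_tensor_le[OF i1(1)[of c] i1(2)[of 1]]
    by (simp only: M.L1_norm_indicator_const[OF A] N.L1_norm_indicator_const[OF B] norm_one mult_1 mult.assoc)
  finally have "norm (x s * y t) * (?p * ?q) + norm (x' s * y' t) * (?p * ?q) \<le> norm c * (?p * ?q)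
      + 2 * \<eta> * (norm (x s) + norm (y t) + 1) * (?p * ?q)
      + 2 * \<eta> * (norm (x' s) + norm (y' t) + 1) * (?p * ?q)"
    using ge R(3) R'(3) by linarith
  then have "\<gamma> * (?p * ?q) \<le> (2 * \<eta> * (K + 1)) * (?p * ?q)"
    by (simp add: \<gamma>_def K_def algebra_simps)
  then have "\<gamma> \<le> 2 * \<eta> * (K + 1)"
    using pq by (rule mult_right_le_imp_le)
  also have "\<dots> \<le> 2 * \<eta> * (K + K)"
    using \<eta>(1) K by (intro mult_left_mono) auto
  also have "\<dots> \<le> \<gamma> / 2"
    using \<eta>K by (simp add: algebra_simps)
  finally show False
    using \<gamma> by simp
qed

subsection \<open>Tensors attaining their projective norm\<close>

lemma NA_proj_tensorE:
  assumes "U \<in> NA_proj_tensor M N"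
  obtains x y where "U \<in> proj_tensor M N" "\<forall>i. integrable M (x i) \<and> integrable N (y i)"
    "(\<lambda>n. proj_tensor_dist M N (proj_tensor_embed M N (tensor_sum M N x y n)) U) \<longlonglongrightarrow> 0"
    "(\<lambda>i. L1_norm M (x i) * L1_norm N (y i)) sums proj_tensor_norm M N U"
proof -
  interpret Metric_space "proj_tensor M N" "proj_tensor_dist M N"
    by (rule Metric_space_proj_tensor)
  obtain x y where U: "U \<in> proj_tensor M N" "\<forall>i. x i \<in> L1 M \<and> y i \<in> L1 N"
    "limitin (proj_tensor_topology M N)
       (\<lambda>n. proj_tensor_embed M N (tensor_sum M N x y n)) U sequentially"
    "(\<lambda>i. L1_norm M (x i) * L1_norm N (y i)) sums proj_tensor_norm M N U"
    using assms unfolding NA_proj_tensor_def mem_Collect_eq by blast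
  have "(\<lambda>n. proj_tensor_dist M N (proj_tensor_embed M N (tensor_sum M N x y n)) U) \<longlonglongrightarrow> 0"
    using U(3) unfolding proj_tensor_topology_def limitin_metric_dist_null by blast
  then show ?thesis
    using that[of x y] U by auto
qed

lemma tensor_sum_in_alg_tensor':
  assumes "\<And>i. integrable M (x i)" "\<And>i. integrable N (y i)"
  shows "tensor_sum M N x y n \<in> alg_tensor M N"
  using assms by (intro tensor_sum_in_alg_tensor) blast

lemma norm_bounded_bilinear_form_le:
  "\<lbrakk>\<beta> \<in> bounded_bilinear_forms M N; integrable M x; integrable N y\<rbrakk>
    \<Longrightarrow> norm (\<beta> x y) \<le> L1_norm M x * L1_norm N y"
  by (simp add: bounded_bilinear_forms_def)

text \<open>If two terms of an optimal series could be represented more cheaply together, replacing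
  them would represent \<open>U\<close> below its norm. The comparison is made on partial sums
  containing both terms, with \<open>d n\<close> as the vanishing error.\<close>

lemma norm_attaining_pair:
  assumes U: "U \<in> proj_tensor M N" and x: "\<And>i. integrable M (x i)" and y: "\<And>i. integrable N (y i)"
    and lim: "(\<lambda>n. proj_tensor_dist M N (proj_tensor_embed M N (tensor_sum M N x y n)) U) \<longlonglongrightarrow> 0"
    and sums: "(\<lambda>i. L1_norm M (x i) * L1_norm N (y i)) sums proj_tensor_norm M N U"
    and "i \<noteq> j"
  shows "L1_norm M (x i) * L1_norm N (y i) + L1_norm M (x j) * L1_norm N (y j) \<le>
    proj_norm M N (\<lambda>\<beta>. elem_tensor M N (x i) (y i) \<beta> + elem_tensor M N (x j) (y j) \<beta>)"
proof -
  define c where "c k = L1_norm M (x k) * L1_norm N (y k)" for k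
  define d where "d n = proj_tensor_dist M N (proj_tensor_embed M N (tensor_sum M N x y n)) U" for n
  let ?e = "\<lambda>k. elem_tensor M N (x k) (y k)"
  let ?P = "\<lambda>\<beta>. ?e i \<beta> + ?e j \<beta>"
  have e: "?e k \<in> alg_tensor M N" for k
    using x y by (rule elem_tensor_in_alg_tensor)
  have bound: "proj_tensor_norm M N U \<le> proj_norm M N ?P + ((\<Sum>k<n. c k) - c i - c j) + d n"
    if n: "max i j < n" for n
  proof -
    let ?I = "{..<n} - {i, j}"
    have split: "(\<Sum>k<n. f k) = (f i + f j) + (\<Sum>k\<in>?I. f k)" for f :: "nat \<Rightarrow> 'z::comm_monoid_add"
      using n \<open>i \<noteq> j\<close> sum.subset_diff[of "{i, j}" "{..<n}" f] by (simp add: add.commute)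
    have T: "tensor_sum M N x y n = (\<lambda>\<beta>. ?P \<beta> + (\<Sum>k\<in>?I. ?e k \<beta>))"
      by (rule ext) (simp only: tensor_sum_def split)
    have "proj_tensor_norm M N U \<le> proj_norm M N (tensor_sum M N x y n) + d n"
      unfolding d_def by (intro proj_tensor_norm_le U tensor_sum_in_alg_tensor' x y)
    also have "proj_norm M N (tensor_sum M N x y n) \<le> proj_norm M N ?P + proj_norm M N (\<lambda>\<beta>. \<Sum>k\<in>?I. ?e k \<beta>)"
      unfolding T by (intro proj_norm_add_le alg_tensor_add alg_tensor_sum e) simp
    also have "proj_norm M N (\<lambda>\<beta>. \<Sum>k\<in>?I. ?e k \<beta>) \<le> (\<Sum>k\<in>?I. proj_norm M N (?e k))"
      by (intro proj_norm_sum_le e) simp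
    also have "\<dots> \<le> (\<Sum>k\<in>?I. c k)"
      unfolding c_def by (intro sum_mono proj_norm_elem_tensor_le x y)
    finally show ?thesis
      by (simp add: split)
  qed
  have "(\<lambda>n. proj_norm M N ?P + ((\<Sum>k<n. c k) - c i - c j) + d n) \<longlonglongrightarrow>
      proj_norm M N ?P + (proj_tensor_norm M N U - c i - c j) + 0"
    using sums lim unfolding sums_def c_def d_def by (intro tendsto_intros)
  then have "proj_tensor_norm M N U \<le> proj_norm M N ?P + (proj_tensor_norm M N U - c i - c j) + 0"
  proof (rule LIMSEQ_le_const)
    show "\<exists>n0. \<forall>n\<ge>n0. proj_tensor_norm M N U \<le> proj_norm M N ?P + ((\<Sum>k<n. c k) - c i - c j) + d n"
      using bound by (intro exI[of _ "Suc (max i j)"]) (simp add: Suc_le_eq)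
  qed
  then show ?thesis
    by (simp add: c_def)
qed

text \<open>Integrate the pointwise bound first in \<open>t\<close>, for almost every fixed
  \<open>s\<close>, and then in \<open>s\<close>. For a single product the iterated integral
  factorises by itself, so iterated almost-everywhere statements suffice in place of a product
  measure.\<close>

lemma inner_rect_form_ge:
  fixes x :: "'a \<Rightarrow> 'k::{real_normed_field,euclidean_space}"
  assumes M: "finite_measure M" and N: "finite_measure N"
    and x: "integrable M x" and y: "integrable N y" and A: "A \<in> sets M" and B: "B \<in> sets N"
    and ge: "AE s in M. s \<in> A \<longrightarrow> (AE t in N. t \<in> B \<longrightarrow> \<kappa> \<le> c \<bullet> (x s * y t))"
  shows "\<kappa> * (measure M A * measure N B) \<le> c \<bullet> rect_form M N A B x y"
proof -
  interpret M: finite_measure M by fact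
  interpret N: finite_measure N by fact
  define w where "w = (\<integral>t\<in>B. y t \<partial>N)"
  have iy: "integrable N (\<lambda>t. indicator B t *\<^sub>R y t)" and ix: "integrable M (\<lambda>s. indicator A s *\<^sub>R x s)"
    using integrable_mult_indicator[OF A x] integrable_mult_indicator[OF B y] by auto
  have cz: "bounded_linear (\<lambda>z. c \<bullet> (a * z))" "bounded_linear (\<lambda>z. c \<bullet> (z * a))" for a :: 'k
    by (rule bounded_linear_compose[OF bounded_linear_inner_right bounded_linear_mult_right]
        bounded_linear_compose[OF bounded_linear_inner_right bounded_linear_mult_left])+
  have inner: "\<kappa> * measure N B \<le> c \<bullet> (x s * w)" if s: "AE t in N. t \<in> B \<longrightarrow> \<kappa> \<le> c \<bullet> (x s * y t)" for s
  proof -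
    have "measure N B * \<kappa> = (\<integral>t. indicator B t *\<^sub>R \<kappa> \<partial>N)"
      using has_bochner_integral_integral_eq[OF N.has_bochner_integral_indicator_const[OF B, of \<kappa>]]
      by (simp only: real_scaleR_def)
    also have "\<dots> \<le> (\<integral>t. c \<bullet> (x s * (indicator B t *\<^sub>R y t)) \<partial>N)"
    proof (rule integral_mono_AE)
      show "integrable N (\<lambda>t. indicator B t *\<^sub>R \<kappa>)"
        by (rule N.integrable_indicator_const[OF B])
      show "integrable N (\<lambda>t. c \<bullet> (x s * (indicator B t *\<^sub>R y t)))"
        by (rule integrable_bounded_linear[OF cz(1) iy])
      show "AE t in N. indicator B t *\<^sub>R \<kappa> \<le> c \<bullet> (x s * (indicator B t *\<^sub>R y t))"
        using s by eventually_elim (simp add: indicator_def)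
    qed
    also have "\<dots> = c \<bullet> (x s * w)"
      unfolding w_def set_lebesgue_integral_def by (rule integral_bounded_linear[OF cz(1) iy])
    finally show ?thesis
      by (simp add: mult.commute)
  qed
  have "measure M A * (\<kappa> * measure N B) = (\<integral>s. indicator A s *\<^sub>R (\<kappa> * measure N B) \<partial>M)"
    using has_bochner_integral_integral_eq[OF M.has_bochner_integral_indicator_const[OF A, of "\<kappa> * measure N B"]]
    by (simp only: real_scaleR_def)
  also have "\<dots> \<le> (\<integral>s. c \<bullet> ((indicator A s *\<^sub>R x s) * w) \<partial>M)"
  proof (rule integral_mono_AE)
    show "integrable M (\<lambda>s. indicator A s *\<^sub>R (\<kappa> * measure N B))"
      by (rule M.integrable_indicator_const[OF A])
    show "integrable M (\<lambda>s. c \<bullet> ((indicator A s *\<^sub>R x s) * w))"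
      by (rule integrable_bounded_linear[OF cz(2) ix])
    show "AE s in M. indicator A s *\<^sub>R (\<kappa> * measure N B) \<le> c \<bullet> ((indicator A s *\<^sub>R x s) * w)"
      using ge by eventually_elim (use inner in \<open>auto simp: indicator_def\<close>)
  qed
  also have "\<dots> = c \<bullet> rect_form M N A B x y"
    unfolding rect_form_def w_def[symmetric] unfolding set_lebesgue_integral_def
    by (rule integral_bounded_linear[OF cz(2) ix])
  finally show ?thesis
    by (simp add: algebra_simps)
qed

text \<open>Finitely many directions suffice to detect a nonzero scalar; this keeps the final cover
  countable.\<close>

lemma exists_signed_Basis_inner_pos:
  fixes z :: "'k::euclidean_space"
  assumes "z \<noteq> 0"
  shows "\<exists>c\<in>Basis \<union> uminus ` Basis. 0 < c \<bullet> z"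
proof -
  obtain b where "b \<in> Basis" "z \<bullet> b \<noteq> 0"
    using assms by (metis euclidean_all_zero_iff)
  then have "0 < b \<bullet> z \<or> 0 < (- b) \<bullet> z"
    by (auto simp: inner_commute)
  with \<open>b \<in> Basis\<close> show ?thesis
    by blast
qed

lemma proj_tensor_eval_tendsto:
  assumes "U \<in> proj_tensor M N" "\<And>i. integrable M (x i)" "\<And>i. integrable N (y i)"
    and lim: "(\<lambda>n. proj_tensor_dist M N (proj_tensor_embed M N (tensor_sum M N x y n)) U) \<longlonglongrightarrow> 0"
    and \<beta>: "\<beta> \<in> bounded_bilinear_forms M N"
  shows "(\<lambda>n. \<Sum>i<n. \<beta> (x i) (y i)) \<longlonglongrightarrow> proj_tensor_eval U \<beta>"
proof -
  have "norm (tensor_sum M N x y n \<beta> - proj_tensor_eval U \<beta>) \<le>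
      proj_tensor_dist M N (proj_tensor_embed M N (tensor_sum M N x y n)) U" for n
    by (intro norm_proj_tensor_eval_diff_le assms tensor_sum_in_alg_tensor')
  then have "(\<lambda>n. tensor_sum M N x y n \<beta> - proj_tensor_eval U \<beta>) \<longlonglongrightarrow> 0"
    by (intro Lim_null_comparison[OF always_eventually lim]) blast
  then show ?thesis
    using \<beta> by (simp add: LIM_zero_iff tensor_sum_apply bounded_bilinear_forms_def)
qed

lemma AE_exists_of_L1_norm_neq_0:
  assumes "L1_norm M x \<noteq> 0" "AE s in M. P s"
  shows "\<exists>s\<in>space M. P s \<and> x s \<noteq> 0"
proof (rule ccontr)
  assume "\<not> ?thesis"
  then have "AE s in M. P s \<longrightarrow> norm (x s) = 0"
    by (intro AE_I2) auto
  with assms(2) have "AE s in M. norm (x s) = 0"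
    by (rule AE_mp)
  then have "L1_norm M x = 0"
    unfolding L1_norm_def by (rule integral_eq_zero_AE)
  with assms(1) show False by simp
qed

text \<open>Fix a term \<open>m\<close> with nonzero factors and a rectangle on which its product
  stays near a nonzero value, in the direction \<open>c\<close>. By alignment every other term has,
  almost everywhere there, a nonnegative component along \<open>c\<close>. Hence term
  \<open>m\<close> bounds every later partial sum from below on each subrectangle, and the bound
  passes to the limit.\<close>

lemma norm_attaining_large_on_rectangle:
  fixes U :: "('a, 'b, 'k::{real_normed_field,euclidean_space}) ptensor"
  assumes M: "finite_measure M" and N: "finite_measure N"
    and NA: "U \<in> NA_proj_tensor M N"
    and nonzero: "proj_tensor_eval U (rect_form M N (space M) (space N)) \<noteq> 0"
  obtains c A B \<kappa> where "c \<in> Basis \<union> uminus ` Basis" "A \<in> sets M" "B \<in> sets N" "0 < \<kappa>"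
    "0 < measure M A" "0 < measure N B"
    "\<forall>A'\<in>sets M. \<forall>B'\<in>sets N. A' \<subseteq> A \<longrightarrow> B' \<subseteq> B \<longrightarrow>
      \<kappa> * (measure M A' * measure N B') \<le> c \<bullet> proj_tensor_eval U (rect_form M N A' B')"
proof -
  interpret M: finite_measure M by fact
  interpret N: finite_measure N by fact
  obtain x y where U: "U \<in> proj_tensor M N" and xy: "\<forall>i. integrable M (x i) \<and> integrable N (y i)"
    and lim: "(\<lambda>n. proj_tensor_dist M N (proj_tensor_embed M N (tensor_sum M N x y n)) U) \<longlonglongrightarrow> 0"
    and sums: "(\<lambda>i. L1_norm M (x i) * L1_norm N (y i)) sums proj_tensor_norm M N U"
    by (rule NA_proj_tensorE[OF NA])
  have x: "integrable M (x i)" and y: "integrable N (y i)" for i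
    using xy by auto
  have [measurable]: "x i \<in> borel_measurable M" "y i \<in> borel_measurable N" for i
    using x y by auto
  note eval = proj_tensor_eval_tendsto[OF U x y lim rect_form_in_bounded_bilinear_forms]
  obtain m where m: "L1_norm M (x m) \<noteq> 0" "L1_norm N (y m) \<noteq> 0"
  proof (rule ccontr)
    assume "\<not> thesis"
    with that have *: "L1_norm M (x i) = 0 \<or> L1_norm N (y i) = 0" for i
      by blast
    have "rect_form M N (space M) (space N) (x i) (y i) = 0" for i
    proof -
      have "norm (rect_form M N (space M) (space N) (x i) (y i)) \<le> L1_norm M (x i) * L1_norm N (y i)"
        by (intro norm_bounded_bilinear_form_le rect_form_in_bounded_bilinear_forms x y) simp_all
      with *[of i] show ?thesis by auto
    qed
    then have "proj_tensor_eval U (rect_form M N (space M) (space N)) = 0"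
      using eval[OF sets.top sets.top] by (simp add: LIMSEQ_const_iff)
    with nonzero show False by contradiction
  qed
  \<comment> \<open>Alignment is only needed between term \<open>m\<close> and each other term,
    which leaves countably many conditions and hence a single null set in each factor.\<close>
  define EM where "EM s \<longleftrightarrow> (\<forall>i. \<forall>\<eta>>0. emeasure M {s' \<in> space M. dist (x m s', x i s') (x m s, x i s) < \<eta>} \<noteq> 0)" for s
  define EN where "EN t \<longleftrightarrow> (\<forall>i. \<forall>\<eta>>0. emeasure N {t' \<in> space N. dist (y m t', y i t') (y m t, y i t) < \<eta>} \<noteq> 0)" for t
  have EM: "AE s in M. EM s"
    unfolding EM_def by (intro AE_all_countable[THEN iffD2] allI AE_emeasure_ball_neq_0) measurable
  have EN: "AE t in N. EN t"
    unfolding EN_def by (intro AE_all_countable[THEN iffD2] allI AE_emeasure_ball_neq_0) measurable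
  have aligned: "norm (x m s * y m t + x i s * y i t) = norm (x m s * y m t) + norm (x i s * y i t)"
    if "EM s" "EN t" "i \<noteq> m" for s t i
    using that norm_attaining_pair[OF U x y lim sums, of m i]
    by (intro norm_add_eq_of_proj_norm_ge[OF M N x x y y]) (auto simp: EM_def EN_def)
  obtain s0 where s0: "EM s0" "x m s0 \<noteq> 0"
    using AE_exists_of_L1_norm_neq_0[OF m(1) EM] by blast
  obtain t0 where t0: "EN t0" "y m t0 \<noteq> 0"
    using AE_exists_of_L1_norm_neq_0[OF m(2) EN] by blast
  have "x m s0 * y m t0 \<noteq> 0"
    using s0 t0 by simp
  then obtain c where c: "c \<in> Basis \<union> uminus ` Basis" "0 < c \<bullet> (x m s0 * y m t0)"
    using exists_signed_Basis_inner_pos by blast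
  \<comment> \<open>Half of the value at the base point leaves room for a neighbourhood on which the
    bound persists.\<close>
  define \<kappa> where "\<kappa> = c \<bullet> (x m s0 * y m t0) / 2"
  have \<kappa>: "0 < \<kappa>" "\<kappa> < c \<bullet> (x m s0 * y m t0)"
    using c(2) by (auto simp: \<kappa>_def)
  have "((\<lambda>z. c \<bullet> (fst z * snd z)) \<longlongrightarrow> c \<bullet> (fst (x m s0, y m t0) * snd (x m s0, y m t0))) (nhds (x m s0, y m t0))"
    by (intro tendsto_intros filterlim_ident)
  then have "\<forall>\<^sub>F z in nhds (x m s0, y m t0). \<kappa> < c \<bullet> (fst z * snd z)"
    by (rule order_tendstoD) (use \<kappa>(2) in simp)
  then obtain \<eta> where \<eta>: "0 < \<eta>" "\<And>z. dist z (x m s0, y m t0) < \<eta> \<Longrightarrow> \<kappa> < c \<bullet> (fst z * snd z)"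
    unfolding eventually_nhds_metric by blast
  \<comment> \<open>The doubled pair is the case \<open>i = m\<close> of \<open>EM\<close>, which
    gives \<open>A\<close> positive measure directly; \<open>\<eta> / 2\<close> in each factor keeps
    the pair of values within \<open>\<eta>\<close>.\<close>
  define A where "A = {s \<in> space M. dist (x m s, x m s) (x m s0, x m s0) < \<eta> / 2}"
  define B where "B = {t \<in> space N. dist (y m t, y m t) (y m t0, y m t0) < \<eta> / 2}"
  have large: "\<kappa> \<le> c \<bullet> (x m s * y m t)" if "s \<in> A" "t \<in> B" for s t
  proof -
    have "dist (x m s) (x m s0) < \<eta> / 2" "dist (y m t) (y m t0) < \<eta> / 2"
      using that dist_fst_le[of "(x m s, x m s)" "(x m s0, x m s0)"]
        dist_fst_le[of "(y m t, y m t)" "(y m t0, y m t0)"] by (auto simp: A_def B_def)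
    then have "dist (x m s, y m t) (x m s0, y m t0) < \<eta>"
      unfolding dist_Pair_Pair
      using sqrt_sum_squares_le_sum[of "dist (x m s) (x m s0)" "dist (y m t) (y m t0)"] by simp
    then show ?thesis
      using \<eta>(2)[of "(x m s, y m t)"] by simp
  qed
  have nonneg: "0 \<le> c \<bullet> (x i s * y i t)" if "s \<in> A" "t \<in> B" "EM s" "EN t" for s t i
  proof (cases "i = m")
    case True
    then show ?thesis using large[OF that(1,2)] \<kappa>(1) by simp
  next
    case False
    let ?z = "x m s * y m t" and ?w = "x i s * y i t"
    \<comment> \<open>Equality in the triangle inequality of a Euclidean norm means that the two
      vectors are nonnegatively proportional, so \<open>?w\<close> cannot point against
      \<open>c\<close> where \<open>?z\<close> points along it.\<close>
    have "norm ?z *\<^sub>R ?w = norm ?w *\<^sub>R ?z"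
      using aligned[OF that(3,4) False] by (simp only: norm_triangle_eq)
    then have "norm ?z * (c \<bullet> ?w) = norm ?w * (c \<bullet> ?z)"
      by (metis inner_scaleR_right)
    moreover have "0 < c \<bullet> ?z"
      using large[OF that(1,2)] \<kappa>(1) by simp
    ultimately have "0 \<le> norm ?z * (c \<bullet> ?w)" "0 < norm ?z"
      by (auto simp: inner_zero_right)
    then show ?thesis
      by (simp add: zero_le_mult_iff)
  qed
  show ?thesis
  proof (rule that[OF c(1) _ _ \<kappa>(1)])
    show "A \<in> sets M" "B \<in> sets N"
      unfolding A_def B_def by measurable
    have "emeasure M A \<noteq> 0" "emeasure N B \<noteq> 0"
      using s0(1) t0(1) \<eta>(1) unfolding EM_def EN_def A_def B_def by (meson half_gt_zero)+
    then show "0 < measure M A" "0 < measure N B"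
      by (simp_all add: M.emeasure_eq_measure N.emeasure_eq_measure zero_less_measure_iff)
    show "\<forall>A'\<in>sets M. \<forall>B'\<in>sets N. A' \<subseteq> A \<longrightarrow> B' \<subseteq> B \<longrightarrow>
      \<kappa> * (measure M A' * measure N B') \<le> c \<bullet> proj_tensor_eval U (rect_form M N A' B')"
    proof (intro ballI impI)
      fix A' B' assume A': "A' \<in> sets M" "A' \<subseteq> A" and B': "B' \<in> sets N" "B' \<subseteq> B"
      have ge0: "0 \<le> c \<bullet> rect_form M N A' B' (x i) (y i)" for i
      proof -
        have "AE s in M. s \<in> A' \<longrightarrow> (AE t in N. t \<in> B' \<longrightarrow> 0 \<le> c \<bullet> (x i s * y i t))"
          using EM
        proof eventually_elim
          case (elim s)
          show ?case
          proof
            assume "s \<in> A'"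
            show "AE t in N. t \<in> B' \<longrightarrow> 0 \<le> c \<bullet> (x i s * y i t)"
              using EN by eventually_elim (use nonneg \<open>s \<in> A'\<close> A' B' elim in blast)
          qed
        qed
        from inner_rect_form_ge[OF M N x y A'(1) B'(1) this] show ?thesis
          by simp
      qed
      have gem: "\<kappa> * (measure M A' * measure N B') \<le> c \<bullet> rect_form M N A' B' (x m) (y m)"
        by (rule inner_rect_form_ge[OF M N x y A'(1) B'(1)]) (use large A'(2) B'(2) in \<open>auto intro!: AE_I2\<close>)
      have lim': "(\<lambda>n. c \<bullet> (\<Sum>i<n. rect_form M N A' B' (x i) (y i))) \<longlonglongrightarrow>
          c \<bullet> proj_tensor_eval U (rect_form M N A' B')"
        by (intro tendsto_inner tendsto_const eval A' B')
      have lower: "\<kappa> * (measure M A' * measure N B') \<le> c \<bullet> (\<Sum>i<n. rect_form M N A' B' (x i) (y i))"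
        if "Suc m \<le> n" for n
      proof -
        have "c \<bullet> rect_form M N A' B' (x m) (y m) \<le> (\<Sum>i<n. c \<bullet> rect_form M N A' B' (x i) (y i))"
          by (rule member_le_sum) (use that ge0 in auto)
        then show ?thesis
          using gem by (simp add: inner_sum_right)
      qed
      show "\<kappa> * (measure M A' * measure N B') \<le> c \<bullet> proj_tensor_eval U (rect_form M N A' B')"
        by (rule LIMSEQ_le_const[OF lim'], rule exI[of _ "Suc m"], intro allI impI lower)
    qed
  qed
qed

subsection \<open>Meagerness\<close>

lemma nowhere_dense_in_subset:
  assumes "nowhere_dense_in X S" "T \<subseteq> S"
  shows "nowhere_dense_in X T"
proof -
  have "X interior_of (X closure_of T) \<subseteq> X interior_of (X closure_of S)"
    using assms(2) by (intro interior_of_mono closure_of_mono)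
  then show ?thesis
    using assms by (auto simp: nowhere_dense_in_def)
qed

lemma meager_inI:
  assumes "countable \<F>" "\<And>F. F \<in> \<F> \<Longrightarrow> nowhere_dense_in X F" "S \<subseteq> \<Union>\<F>"
  shows "meager_in X S"
proof (cases "\<F> = {}")
  case True
  then show ?thesis
    using assms(3) by (auto simp: meager_in_def nowhere_dense_in_def intro!: exI[of _ "\<lambda>_. {}"])
next
  case False
  \<comment> \<open>Since \<open>meager_in\<close> demands that the union equal the set, the members
    of the cover are cut down to \<open>S\<close>.\<close>
  let ?F = "\<lambda>n. from_nat_into \<F> n \<inter> S"
  have nowhere: "\<forall>n. nowhere_dense_in X (?F n)"
    using assms(2)[OF from_nat_into[OF False]] by (auto intro: nowhere_dense_in_subset)
  have "(\<Union>n. ?F n) = (\<Union>n. from_nat_into \<F> n) \<inter> S"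
    by blast
  also have "(\<Union>n. from_nat_into \<F> n) = \<Union>\<F>"
    using range_from_nat_into[OF False assms(1)] by simp
  also have "\<Union>\<F> \<inter> S = S"
    using assms(3) by (simp add: Int_absorb1)
  finally have "S = (\<Union>n. ?F n)" ..
  with nowhere show ?thesis
    unfolding meager_in_def by (intro exI[of _ ?F] conjI)
qed

text \<open>The integrated form of a pointwise lower bound \<open>\<alpha>\<close> in the direction
  \<open>c\<close> on \<open>A \<times> B\<close>. One parameter bounds both sides and the density,
  so the values \<open>1 / Suc n\<close> give a countable family.\<close>

definition large_on_rectangle ::
  "'a measure \<Rightarrow> 'b measure \<Rightarrow> real \<Rightarrow> 'k::{real_normed_field,euclidean_space} \<Rightarrow> ('a, 'b, 'k) ptensor set" where
  "large_on_rectangle M N \<alpha> c = {U \<in> proj_tensor M N. \<exists>A\<in>sets M. \<exists>B\<in>sets N.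
     \<alpha> \<le> measure M A \<and> \<alpha> \<le> measure N B \<and>
     (\<forall>A'\<in>sets M. \<forall>B'\<in>sets N. A' \<subseteq> A \<longrightarrow> B' \<subseteq> B \<longrightarrow>
       \<alpha> * (measure M A' * measure N B') \<le> c \<bullet> proj_tensor_eval U (rect_form M N A' B'))}"

section \<open>Erasing a tensor on small sets\<close>

lemma indicator_scaleR_indicator_scaleR:
  fixes z :: "'k::real_vector"
  shows "indicator A s *\<^sub>R (indicator C s *\<^sub>R z) = (indicator (A \<inter> C) s :: real) *\<^sub>R z"
  by (simp add: indicator_def)

lemma rect_form_restrictions:
  assumes "A \<subseteq> C" "B \<subseteq> D"
  shows "rect_form M N A B (\<lambda>s. indicator C s *\<^sub>R x s) (\<lambda>t. indicator D t *\<^sub>R y t) = rect_form M N A B x y"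
  unfolding rect_form_def set_lebesgue_integral_def indicator_scaleR_indicator_scaleR
  using assms by (simp only: Int_absorb2)

lemma rect_form_disjoint_restriction:
  assumes "B \<inter> D = {}"
  shows "rect_form M N A B x (\<lambda>t. indicator D t *\<^sub>R y t) = 0"
  unfolding rect_form_def set_lebesgue_integral_def indicator_scaleR_indicator_scaleR
  by (simp add: assms)

lemma sum_L1_norm_restrictions_le:
  assumes "integrable N y" "finite L" "\<And>j. j \<in> L \<Longrightarrow> B j \<in> sets N" "disjoint_family_on B L"
  shows "(\<Sum>j\<in>L. L1_norm N (\<lambda>t. indicator (B j) t *\<^sub>R y t)) \<le> L1_norm N y"
proof -
  have int: "integrable N (\<lambda>t. indicator (B j) t *\<^sub>R y t)" if "j \<in> L" for j
    using assms(3)[OF that] assms(1) by (rule integrable_mult_indicator)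
  have "(\<Sum>j\<in>L. L1_norm N (\<lambda>t. indicator (B j) t *\<^sub>R y t)) =
      (\<integral>t. (\<Sum>j\<in>L. norm (indicator (B j) t *\<^sub>R y t)) \<partial>N)"
    unfolding L1_norm_def by (intro Bochner_Integration.integral_sum[symmetric] integrable_norm int)
  also have "\<dots> \<le> L1_norm N y"
    unfolding L1_norm_def
  proof (rule integral_mono)
    show "integrable N (\<lambda>t. \<Sum>j\<in>L. norm (indicator (B j) t *\<^sub>R y t))"
      by (intro Bochner_Integration.integrable_sum integrable_norm int)
    fix t
    have "(\<Sum>j\<in>L. norm (indicator (B j) t *\<^sub>R y t)) = (\<Sum>j\<in>L. indicator (B j) t) * norm (y t)"
      by (simp add: sum_distrib_right)
    also have "(\<Sum>j\<in>L. indicator (B j) t) = (indicator (\<Union>j\<in>L. B j) t :: real)"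
      by (rule indicator_UN_disjoint[symmetric]) (use assms in auto)
    also have "\<dots> * norm (y t) \<le> norm (y t)"
      by (simp add: indicator_def)
    finally show "(\<Sum>j\<in>L. norm (indicator (B j) t *\<^sub>R y t)) \<le> norm (y t)" .
  qed (use assms(1) in simp)
  finally show ?thesis .
qed

text \<open>
  Erasing a tensor on \<open>\<Union>j\<in>L. C j \<times> B j\<close> costs little, because the sets \<open>C j\<close> are small and the
  sets \<open>B j\<close> are disjoint. Yet every large rectangle meets the erased set in a rectangle whose measure
  is bounded below.
\<close>
lemma exists_vanishing_approximation:
  fixes g :: "('a, 'b, 'k::{real_normed_field,banach,second_countable_topology}) tensor"
  assumes M: "finite_measure M" "atomless M" "0 < measure M (space M)"
    and N: "finite_measure N" "atomless N" "0 < measure N (space N)"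
    and "0 < \<alpha>" "0 < \<epsilon>" "g \<in> alg_tensor M N"
  obtains h \<theta> where "h \<in> alg_tensor M N" "tensor_dist M N g h < \<epsilon>" "0 < \<theta>"
    "\<And>A B. A \<in> sets M \<Longrightarrow> B \<in> sets N \<Longrightarrow> \<alpha> \<le> measure M A \<Longrightarrow> \<alpha> \<le> measure N B \<Longrightarrow>
      \<exists>A'\<in>sets M. \<exists>B'\<in>sets N. A' \<subseteq> A \<and> B' \<subseteq> B \<and> \<theta> \<le> measure M A' \<and> \<theta> \<le> measure N B' \<and>
        h (rect_form M N A' B') = 0"
proof -
  interpret M: finite_measure M by fact
  interpret N: finite_measure N by fact
  obtain x y n where xy: "\<forall>i<n. integrable M (x i) \<and> integrable N (y i)"
    and g: "g = tensor_sum M N x y n"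
    by (rule alg_tensorE[OF assms(9)])
  have x: "integrable M (x i)" and y: "integrable N (y i)" if "i < n" for i
    using xy that by auto
  define Y where "Y = (\<Sum>i<n. L1_norm N (y i))"
  have Y: "0 \<le> Y"
    by (simp add: Y_def sum_nonneg)
  \<comment> \<open>The total cost of erasing will be at most \<open>\<epsilon>' * Y\<close>; the
    summand 1 keeps the quotient defined when \<open>Y = 0\<close>.\<close>
  define \<epsilon>' where "\<epsilon>' = \<epsilon> / (Y + 1)"
  have \<epsilon>': "0 < \<epsilon>'" "\<epsilon>' * Y < \<epsilon>"
    using Y \<open>0 < \<epsilon>\<close> by (auto simp: \<epsilon>'_def field_simps)
  \<comment> \<open>Absolute continuity is applied to the sum of all the norms, so that one
    \<open>\<delta>\<close> serves every term.\<close>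
  obtain \<delta> where \<delta>: "0 < \<delta>" "\<And>A. A \<in> sets M \<Longrightarrow> measure M A < \<delta> \<Longrightarrow>
      (\<integral>s\<in>A. (\<Sum>i<n. norm (x i s)) \<partial>M) < \<epsilon>'"
    by (rule M.integral_absolutely_continuous[of "\<lambda>s. \<Sum>i<n. norm (x i s)" \<epsilon>'])
      (use x \<epsilon>' in \<open>auto intro!: sum_nonneg Bochner_Integration.integrable_sum\<close>)
  obtain L :: "nat list set" and C B \<theta> where L: "finite L" "\<And>j. j \<in> L \<Longrightarrow> C j \<in> sets M"
      "\<And>j. j \<in> L \<Longrightarrow> measure M (C j) < \<delta>" "\<And>j. j \<in> L \<Longrightarrow> B j \<in> sets N" "disjoint_family_on B L"
    and \<theta>: "0 < \<theta>" "\<And>X Y. X \<in> sets M \<Longrightarrow> Y \<in> sets N \<Longrightarrow> \<alpha> \<le> measure M X \<Longrightarrow> \<alpha> \<le> measure N Y \<Longrightarrow>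
       \<exists>j\<in>L. \<theta> \<le> measure M (X \<inter> C j) \<and> \<theta> \<le> measure N (Y \<inter> B j)"
    using exists_small_set_meeting_large_rectangles[OF M N \<open>0 < \<alpha>\<close> \<delta>(1)] by metis
  define xC where "xC i j s = indicator (C j) s *\<^sub>R x i s" for i j s
  define yB where "yB i j t = indicator (B j) t *\<^sub>R y i t" for i j t
  have ixC: "integrable M (xC i j)" and iyB: "integrable N (yB i j)" if "i < n" "j \<in> L" for i j
    unfolding xC_def yB_def using that L x y by (auto intro: integrable_mult_indicator)
  \<comment> \<open>The restriction of \<open>g\<close> to the union of the rectangles
    \<open>C j \<times> B j\<close>, which are disjoint because the sets \<open>B j\<close>
    are.\<close>
  define E where "E = (\<lambda>\<beta>. \<Sum>i<n. \<Sum>j\<in>L. elem_tensor M N (xC i j) (yB i j) \<beta>)"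
  have e: "elem_tensor M N (xC i j) (yB i j) \<in> alg_tensor M N" if "i < n" "j \<in> L" for i j
    using ixC[OF that] iyB[OF that] by (rule elem_tensor_in_alg_tensor)
  have E: "E \<in> alg_tensor M N"
    unfolding E_def using L(1) e by (intro alg_tensor_sum) auto
  have xC_small: "L1_norm M (xC i j) \<le> \<epsilon>'" if "i < n" "j \<in> L" for i j
  proof -
    have "L1_norm M (xC i j) \<le> (\<integral>s\<in>C j. (\<Sum>i<n. norm (x i s)) \<partial>M)"
      unfolding L1_norm_def set_lebesgue_integral_def
    proof (rule integral_mono)
      show "integrable M (\<lambda>s. norm (xC i j s))"
        using ixC[OF that] by (rule integrable_norm)
      show "integrable M (\<lambda>s. indicator (C j) s *\<^sub>R (\<Sum>i<n. norm (x i s)))"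
        using x L(2)[OF that(2)] by (intro integrable_mult_indicator Bochner_Integration.integrable_sum) auto
      fix s
      have "norm (x i s) \<le> (\<Sum>i<n. norm (x i s))"
        using that by (intro member_le_sum) auto
      then show "norm (xC i j s) \<le> indicator (C j) s *\<^sub>R (\<Sum>i<n. norm (x i s))"
        by (simp add: xC_def indicator_def)
    qed
    then show ?thesis
      using \<delta>(2) L(2,3) that by force
  qed
  have "proj_norm M N E \<le> (\<Sum>i<n. \<Sum>j\<in>L. proj_norm M N (elem_tensor M N (xC i j) (yB i j)))"
    unfolding E_def using L(1) e
    by (intro order_trans[OF proj_norm_sum_le] sum_mono proj_norm_sum_le alg_tensor_sum) auto
  also have "\<dots> \<le> (\<Sum>i<n. \<Sum>j\<in>L. \<epsilon>' * L1_norm N (yB i j))"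
  proof (intro sum_mono)
    fix i j assume "i \<in> {..<n}" "j \<in> L"
    then have ij: "i < n" "j \<in> L" by auto
    have "proj_norm M N (elem_tensor M N (xC i j) (yB i j)) \<le> L1_norm M (xC i j) * L1_norm N (yB i j)"
      using ixC[OF ij] iyB[OF ij] by (rule proj_norm_elem_tensor_le)
    also have "\<dots> \<le> \<epsilon>' * L1_norm N (yB i j)"
      using xC_small[OF ij] by (intro mult_right_mono) auto
    finally show "proj_norm M N (elem_tensor M N (xC i j) (yB i j)) \<le> \<epsilon>' * L1_norm N (yB i j)" .
  qed
  also have "\<dots> = (\<Sum>i<n. \<epsilon>' * (\<Sum>j\<in>L. L1_norm N (yB i j)))"
    by (simp add: sum_distrib_left)
  also have "\<dots> \<le> (\<Sum>i<n. \<epsilon>' * L1_norm N (y i))"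
    unfolding yB_def using \<epsilon>'(1) y L
    by (intro sum_mono mult_left_mono sum_L1_norm_restrictions_le) auto
  also have "\<dots> = \<epsilon>' * Y"
    by (simp add: Y_def sum_distrib_left)
  finally have E_small: "proj_norm M N E < \<epsilon>"
    using \<epsilon>'(2) by simp
  define h where "h = (\<lambda>\<beta>. g \<beta> - E \<beta>)"
  show ?thesis
  proof (rule that[of h \<theta>])
    show "h \<in> alg_tensor M N"
      unfolding h_def by (intro alg_tensor_diff assms(9) E)
    show "tensor_dist M N g h < \<epsilon>"
      using E_small by (simp add: tensor_dist_def h_def)
    fix A1 B1 assume AB: "A1 \<in> sets M" "B1 \<in> sets N" "\<alpha> \<le> measure M A1" "\<alpha> \<le> measure N B1"
    then obtain j where j: "j \<in> L" "\<theta> \<le> measure M (A1 \<inter> C j)" "\<theta> \<le> measure N (B1 \<inter> B j)"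
      using \<theta>(2) by blast
    let ?\<beta> = "rect_form M N (A1 \<inter> C j) (B1 \<inter> B j) :: ('a \<Rightarrow> 'k) \<Rightarrow> ('b \<Rightarrow> 'k) \<Rightarrow> 'k"
    have sets: "A1 \<inter> C j \<in> sets M" "B1 \<inter> B j \<in> sets N"
      using AB L(2,4) j(1) by auto
    then have \<beta>: "?\<beta> \<in> bilinear_forms M N"
      by (rule rect_form_in_bilinear_forms)
    \<comment> \<open>On a subrectangle of \<open>C j \<times> B j\<close> only the summand
      \<open>k = j\<close> survives and it equals the original term, so \<open>E\<close> and
      \<open>g\<close> agree there.\<close>
    have "?\<beta> (xC i k) (yB i k) = (if k = j then ?\<beta> (x i) (y i) else 0)" if "k \<in> L" for i k
    proof (cases "k = j")
      case True
      then show ?thesis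
        unfolding xC_def yB_def by (simp add: rect_form_restrictions)
    next
      case False
      then have "B1 \<inter> B j \<inter> B k = {}"
        using L(5) j(1) that by (auto simp: disjoint_family_on_def)
      then show ?thesis
        using False unfolding yB_def by (simp add: rect_form_disjoint_restriction)
    qed
    then have "E ?\<beta> = (\<Sum>i<n. \<Sum>k\<in>L. if k = j then ?\<beta> (x i) (y i) else 0)"
      unfolding E_def using \<beta> by (intro sum.cong refl) (simp add: elem_tensor_def)
    also have "\<dots> = g ?\<beta>"
      using L(1) j(1) \<beta> by (simp add: g tensor_sum_apply)
    finally have "h ?\<beta> = 0"
      by (simp add: h_def)
    then show "\<exists>A'\<in>sets M. \<exists>B'\<in>sets N. A' \<subseteq> A1 \<and> B' \<subseteq> B1 \<and> \<theta> \<le> measure M A' \<and> \<theta> \<le> measure N B' \<and>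
        h (rect_form M N A' B') = 0"
      using sets j by (intro bexI[of _ "A1 \<inter> C j"] bexI[of _ "B1 \<inter> B j"]) auto
  qed (use \<theta> in auto)
qed

text \<open>Every \<open>V\<close> in the set has, on some subrectangle with sides of measure at
  least \<open>\<theta>\<close>, an integral of size at least
  \<open>\<alpha> * (\<theta> * \<theta>)\<close>, whereas that of \<open>h\<close> is 0. The
  integral is a contraction and \<open>\<theta>\<close> does not depend on \<open>V\<close>, so
  \<open>h\<close> keeps a fixed distance from the whole set.\<close>

lemma nowhere_dense_large_on_rectangle:
  fixes c :: "'k::{real_normed_field,euclidean_space}"
  assumes M: "finite_measure M" "atomless M" "0 < measure M (space M)"
    and N: "finite_measure N" "atomless N" "0 < measure N (space N)"
    and "0 < \<alpha>" "norm c \<le> 1"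
  shows "nowhere_dense_in (proj_tensor_topology M N) (large_on_rectangle M N \<alpha> c)"
proof (rule nowhere_dense_in_proj_tensor)
  show "large_on_rectangle M N \<alpha> c \<subseteq> proj_tensor M N"
    by (auto simp: large_on_rectangle_def)
  fix g :: "('a, 'b, 'k) tensor" and \<epsilon> :: real
  assume g: "g \<in> alg_tensor M N" and "0 < \<epsilon>"
  obtain h \<theta> where h: "h \<in> alg_tensor M N" "tensor_dist M N g h < \<epsilon>" "0 < \<theta>"
    and vanish: "\<And>A B. A \<in> sets M \<Longrightarrow> B \<in> sets N \<Longrightarrow> \<alpha> \<le> measure M A \<Longrightarrow> \<alpha> \<le> measure N B \<Longrightarrow>
      \<exists>A'\<in>sets M. \<exists>B'\<in>sets N. A' \<subseteq> A \<and> B' \<subseteq> B \<and> \<theta> \<le> measure M A' \<and> \<theta> \<le> measure N B' \<and>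
        h (rect_form M N A' B') = 0"
    using exists_vanishing_approximation[OF M N \<open>0 < \<alpha>\<close> \<open>0 < \<epsilon>\<close> g] by blast
  have "\<alpha> * (\<theta> * \<theta>) \<le> proj_tensor_dist M N (proj_tensor_embed M N h) V"
    if "V \<in> large_on_rectangle M N \<alpha> c" for V
  proof -
    obtain A B where V: "V \<in> proj_tensor M N" and AB: "A \<in> sets M" "B \<in> sets N"
      "\<alpha> \<le> measure M A" "\<alpha> \<le> measure N B"
      and large: "\<forall>A'\<in>sets M. \<forall>B'\<in>sets N. A' \<subseteq> A \<longrightarrow> B' \<subseteq> B \<longrightarrow>
       \<alpha> * (measure M A' * measure N B') \<le> c \<bullet> proj_tensor_eval V (rect_form M N A' B')"
      using \<open>V \<in> large_on_rectangle M N \<alpha> c\<close> unfolding large_on_rectangle_def by blast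
    obtain A' B' where AB': "A' \<in> sets M" "B' \<in> sets N" "A' \<subseteq> A" "B' \<subseteq> B"
      "\<theta> \<le> measure M A'" "\<theta> \<le> measure N B'" and zero: "h (rect_form M N A' B') = 0"
      using vanish[OF AB] by blast
    have "\<theta> * \<theta> \<le> measure M A' * measure N B'"
      using AB'(5,6) h(3) by (intro mult_mono) auto
    then have "\<alpha> * (\<theta> * \<theta>) \<le> \<alpha> * (measure M A' * measure N B')"
      using \<open>0 < \<alpha>\<close> by (intro mult_left_mono) auto
    also have "\<dots> \<le> c \<bullet> proj_tensor_eval V (rect_form M N A' B')"
      using large AB' by blast
    also have "\<dots> \<le> norm c * norm (proj_tensor_eval V (rect_form M N A' B'))"
      by (rule norm_cauchy_schwarz)
    also have "\<dots> \<le> 1 * norm (h (rect_form M N A' B') - proj_tensor_eval V (rect_form M N A' B'))"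
      using \<open>norm c \<le> 1\<close> by (intro mult_mono) (auto simp: zero)
    also have "\<dots> \<le> proj_tensor_dist M N (proj_tensor_embed M N h) V"
      unfolding mult_1
      by (intro norm_proj_tensor_eval_diff_le V h(1) rect_form_in_bounded_bilinear_forms AB')
    finally show ?thesis .
  qed
  moreover have "0 < \<alpha> * (\<theta> * \<theta>)"
    using h(3) \<open>0 < \<alpha>\<close> by simp
  ultimately show "\<exists>h\<in>alg_tensor M N. tensor_dist M N g h < \<epsilon> \<and>
      (\<exists>r>0. \<forall>V\<in>large_on_rectangle M N \<alpha> c. r \<le> proj_tensor_dist M N (proj_tensor_embed M N h) V)"
    using h by blast
qed

text \<open>A tensor \<open>h\<close> is at distance at least the norm of its integral from every
  tensor of integral 0, so it suffices to make the integral of a given tensor nonzero by a small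
  change.\<close>

lemma nowhere_dense_kernel_of_integral:
  fixes M :: "'a measure" and N :: "'b measure"
  assumes M: "finite_measure M" "0 < measure M (space M)"
    and N: "finite_measure N" "0 < measure N (space N)"
  shows "nowhere_dense_in (proj_tensor_topology M N)
    {U \<in> proj_tensor M N. proj_tensor_eval U (rect_form M N (space M) (space N)) =
      (0::'k::{real_normed_field,banach,second_countable_topology})}"
    (is "nowhere_dense_in _ ?F")
proof (rule nowhere_dense_in_proj_tensor)
  interpret M: finite_measure M by fact
  interpret N: finite_measure N by fact
  let ?\<beta> = "rect_form M N (space M) (space N) :: ('a \<Rightarrow> 'k) \<Rightarrow> ('b \<Rightarrow> 'k) \<Rightarrow> 'k"
  let ?\<mu> = "measure M (space M)" and ?\<nu> = "measure N (space N)"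
  show "?F \<subseteq> proj_tensor M N" by blast
  fix g :: "('a, 'b, 'k) tensor" and \<epsilon> :: real
  assume g: "g \<in> alg_tensor M N" and "0 < \<epsilon>"
  note \<beta> = rect_form_in_bounded_bilinear_forms[OF sets.top[of M] sets.top[of N]]
  have "\<exists>h\<in>alg_tensor M N. tensor_dist M N g h < \<epsilon> \<and> h ?\<beta> \<noteq> 0"
  proof (cases "g ?\<beta> = 0")
    case False
    then show ?thesis
      using g \<open>0 < \<epsilon>\<close> by (intro bexI[of _ g]) (auto simp: tensor_dist_self)
  next
    case True
    \<comment> \<open>Chosen so that the constant tensor to be subtracted has cost
      \<open>\<epsilon> / 2\<close> and nonzero integral.\<close>
    define c where "c = \<epsilon> / (2 * ?\<mu> * ?\<nu>)"
    have c: "0 < c" "c * ?\<mu> * ?\<nu> < \<epsilon>"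
      using M N \<open>0 < \<epsilon>\<close> by (auto simp: c_def)
    define x :: "'a \<Rightarrow> 'k" where "x = (\<lambda>s. indicator (space M) s *\<^sub>R of_real c)"
    define y :: "'b \<Rightarrow> 'k" where "y = (\<lambda>t. indicator (space N) t *\<^sub>R 1)"
    have x: "integrable M x" "L1_norm M x = c * ?\<mu>"
      unfolding x_def using M.integrable_indicator_const[OF sets.top] c
        M.L1_norm_indicator_const[OF sets.top, of "of_real c :: 'k"] by auto
    have y: "integrable N y" "L1_norm N y = ?\<nu>"
      unfolding y_def using N.integrable_indicator_const[OF sets.top]
        N.L1_norm_indicator_const[OF sets.top, of "1 :: 'k"] by auto
    let ?e = "elem_tensor M N x y"
    have e: "?e \<in> alg_tensor M N"
      using x(1) y(1) by (rule elem_tensor_in_alg_tensor)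
    let ?h = "\<lambda>\<beta>. g \<beta> - ?e \<beta>"
    have "tensor_dist M N g ?h \<le> c * ?\<mu> * ?\<nu>"
      using proj_norm_elem_tensor_le[OF x(1) y(1)] by (simp add: tensor_dist_def x y)
    moreover have "?\<beta> x y = (?\<mu> *\<^sub>R of_real c) * (?\<nu> *\<^sub>R 1)"
      unfolding rect_form_def x_def y_def set_lebesgue_integral_def indicator_scaleR_indicator_scaleR Int_absorb
      by (intro arg_cong2[of _ _ _ _ "(*)"] has_bochner_integral_integral_eq
          M.has_bochner_integral_indicator_const N.has_bochner_integral_indicator_const sets.top)
    then have "?h ?\<beta> \<noteq> 0"
      using c M N True rect_form_in_bilinear_forms[OF sets.top[of M] sets.top[of N]]
      by (simp add: elem_tensor_def)
    ultimately show ?thesis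
      using c(2) alg_tensor_diff[OF g e] by (intro bexI[of _ ?h]) auto
  qed
  then obtain h where h: "h \<in> alg_tensor M N" "tensor_dist M N g h < \<epsilon>" "h ?\<beta> \<noteq> 0"
    by blast
  have "norm (h ?\<beta>) \<le> proj_tensor_dist M N (proj_tensor_embed M N h) V" if "V \<in> ?F" for V
  proof -
    have V: "V \<in> proj_tensor M N" "proj_tensor_eval V ?\<beta> = 0"
      using that by auto
    show ?thesis
      using norm_proj_tensor_eval_diff_le[OF V(1) h(1) \<beta>] V(2) by simp
  qed
  then show "\<exists>h\<in>alg_tensor M N. tensor_dist M N g h < \<epsilon> \<and>
      (\<exists>r>0. \<forall>V\<in>?F. r \<le> proj_tensor_dist M N (proj_tensor_embed M N h) V)"
    using h by (intro bexI[of _ h] conjI exI[of _ "norm (h ?\<beta>)"]) auto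
qed

text \<open>The sort of the scalars covers the real and the complex numbers at once. Positive total
  measures matter: over a null measure the tensor product is a single point, which attains its norm
  and is not meager in itself.\<close>

lemma meager_NA_proj_tensor:
  fixes M :: "'a measure" and N :: "'b measure"
  assumes M: "finite_measure M" "atomless M" "emeasure M (space M) \<noteq> 0"
    and N: "finite_measure N" "atomless N" "emeasure N (space N) \<noteq> 0"
  shows "meager_in (proj_tensor_topology M N)
    (NA_proj_tensor M N :: ('a, 'b, 'k::{real_normed_field,euclidean_space}) ptensor set)"
proof -
  interpret M: finite_measure M by fact
  interpret N: finite_measure N by fact
  have pos: "0 < measure M (space M)" "0 < measure N (space N)"
    using M(3) N(3) by (auto simp: M.emeasure_eq_measure N.emeasure_eq_measure zero_less_measure_iff)
  let ?F0 = "{U \<in> proj_tensor M N. proj_tensor_eval U (rect_form M N (space M) (space N)) = (0::'k)}"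
  define D where "D = (Basis \<union> uminus ` Basis :: 'k set)"
  define \<F> where "\<F> = insert ?F0 ((\<lambda>(n::nat, c). large_on_rectangle M N (1 / Suc n) c) ` (UNIV \<times> D))"
  show ?thesis
  proof (rule meager_inI[of \<F>])
    have "countable D"
      by (rule countable_finite) (simp add: D_def)
    then show "countable \<F>"
      by (auto simp: \<F>_def)
    fix F assume "F \<in> \<F>"
    then show "nowhere_dense_in (proj_tensor_topology M N) F"
      by (auto simp: \<F>_def D_def
          intro!: nowhere_dense_kernel_of_integral[OF M(1) pos(1) N(1) pos(2)]
            nowhere_dense_large_on_rectangle[OF M(1,2) pos(1) N(1,2) pos(2)])
  next
    show "NA_proj_tensor M N \<subseteq> \<Union>\<F>"
    proof
      fix U :: "('a, 'b, 'k) ptensor" assume U: "U \<in> NA_proj_tensor M N"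
      then have UP: "U \<in> proj_tensor M N"
        by (simp add: NA_proj_tensor_def)
      show "U \<in> \<Union>\<F>"
      proof (cases "proj_tensor_eval U (rect_form M N (space M) (space N)) = 0")
        case True
        then show ?thesis
          using UP by (auto simp: \<F>_def)
      next
        case False
        obtain c A B \<kappa> where c: "c \<in> Basis \<union> uminus ` Basis" and AB: "A \<in> sets M" "B \<in> sets N"
          and \<kappa>: "0 < \<kappa>" and m: "0 < measure M A" "0 < measure N B"
          and large: "\<forall>A'\<in>sets M. \<forall>B'\<in>sets N. A' \<subseteq> A \<longrightarrow> B' \<subseteq> B \<longrightarrow>
            \<kappa> * (measure M A' * measure N B') \<le> c \<bullet> proj_tensor_eval U (rect_form M N A' B')"
          by (rule norm_attaining_large_on_rectangle[OF M(1) N(1) U False])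
        \<comment> \<open>A single \<open>n\<close> has to undercut the density and both measures,
          because \<open>large_on_rectangle\<close> has one parameter for all three.\<close>
        obtain n where n: "1 / Suc n < min \<kappa> (min (measure M A) (measure N B))"
          by (rule nat_approx_posE[of "min \<kappa> (min (measure M A) (measure N B))"]) (use \<kappa> m in auto)
        have "1 / Suc n * (measure M A' * measure N B') \<le> c \<bullet> proj_tensor_eval U (rect_form M N A' B')"
          if "A' \<in> sets M" "B' \<in> sets N" "A' \<subseteq> A" "B' \<subseteq> B" for A' B'
          using large that n mult_right_mono[of "1 / Suc n" \<kappa> "measure M A' * measure N B'"]
          by fastforce
        then have "U \<in> large_on_rectangle M N (1 / Suc n) c"
          using UP AB n unfolding large_on_rectangle_def mem_Collect_eq
          by (intro conjI bexI[of _ A] bexI[of _ B] ballI impI) simp_all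
        then show ?thesis
          using c by (auto simp: \<F>_def D_def)
      qed
    qed
  qed
qed

theorem proposition4p12:
  fixes M :: "'a measure" and N :: "'b measure"
  assumes "finite_measure M" and "atomless M" and "emeasure M (space M) \<noteq> 0"
    and "finite_measure N" and "atomless N" and "emeasure N (space N) \<noteq> 0"
  shows "meager_in (proj_tensor_topology M N) (NA_proj_tensor M N :: ('a, 'b, real) ptensor set) \<and>
         meager_in (proj_tensor_topology M N) (NA_proj_tensor M N :: ('a, 'b, complex) ptensor set)"
  by (intro conjI meager_NA_proj_tensor assms)

end
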